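(* Let $(M^n,\phi,\xi,\eta,g)$ be an $n$-dimensional para-Sasakian manifold, equipped with the quarter-symmetric metric connection $\tilde\nabla_X Y=\nabla_X Y+\eta(Y)\phi X-g(\phi X,Y)\xi$, where $\nabla$ is the Levi-Civita connection of $g$. Let $\tilde R$ and $\tilde S$ be the curvature tensor and Ricci tensor of $\tilde\nabla$. Suppose that $M^n$ is pseudosymmetric with respect to $\tilde\nabla$, i.e. there is a function $L_{\tilde R}$ on $U_{\tilde R}=\{x\in M^n:\tilde R\neq 0\text{ at }x\}$ such that $$\tilde R(X,Y)\cdot\tilde R=L_{\tilde R}\,[(X\wedge_g Y)\cdot\tilde R]$$ holds on $U_{\tilde R}$ for all vector fields $X,Y$. Then $M^n$ is an Einstein manifold with respect to $\tilde\nabla$, or $L_{\tilde R}=-2$.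
   Context: Para-Sasakian manifold: a differentiable manifold $M^n$ with a $(1,1)$-tensor field $\phi$, a vector field $\xi$, a 1-form $\eta$ and a Riemannian metric $g$ such that, for all vector fields $X,Y$: $\phi^2X=X-\eta(X)\xi$, $\eta(\xi)=1$, $\phi\xi=0$, $\eta(\phi X)=0$, $g(X,\xi)=\eta(X)$, $g(\phi X,\phi Y)=g(X,Y)-\eta(X)\eta(Y)$, and moreover $(\nabla_X\phi)Y=-g(X,Y)\xi-\eta(Y)X+2\eta(X)\eta(Y)\xi$, $d\eta=0$, $\nabla_X\xi=\phi X$, with $\nabla$ the Levi-Civita connection of $g$. Curvature: $\tilde R(X,Y)Z=\tilde\nabla_X\tilde\nabla_YZ-\tilde\nabla_Y\tilde\nabla_XZ-\tilde\nabla_{[X,Y]}Z$. Ricci tensor: $\tilde S(Y,Z)=\mathrm{trace}\{X\mapsto\tilde R(X,Y)Z\}$. $(X\wedge_gY)$ is the endomorphism $(X\wedge_gY)Z=g(Y,Z)X-g(X,Z)Y$. For an endomorphism $A$ (here $A=\tilde R(X,Y)$ or $A=X\wedge_gY$) acting as a derivation on a $(1,3)$-tensor $T$: $(A\cdot T)(U,V)W=A(T(U,V)W)-T(AU,V)W-T(U,AV)W-T(U,V)AW$. $M^n$ is Einstein with respect to $\tilde\nabla$ if $\tilde S$ is a constant multiple of $g$.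
   Formalization: The function L on U is assumed continuous; for arbitrary L the claim fails, since L is undetermined at points where the curvature equals -2 times X∧Y (e.g. on R×S² with metric dt²+e^{2t}g₁, g₁ of curvature 2, at t=0). *)

theory Defs
  imports "HOL-Analysis.Analysis" "HOL-Library.Function_Algebras"
begin

text \<open>
  Conventions. \<open>Function_Algebras\<close> makes \<open>0\<close>, \<open>+\<close>, \<open>-\<close> and \<open>*\<close> on function types pointwise; this
  is what these symbols mean below for real functions and for vector fields.

  An \<open>n\<close>-dimensional manifold is a Hausdorff, second countable type \<open>'m\<close> with a smooth atlas modelled
  on \<open>real^'n\<close>, where \<open>n = CARD('n)\<close>. Connectedness is not assumed. Vector fields are derivations
  of the algebra of smooth functions, and tensor fields are maps on vector fields that are linear
  over that algebra.
\<close>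


section \<open>Smooth manifolds\<close>

text \<open>Used for open \<open>S\<close> only.\<close>

primrec Ck_on ::
  "nat \<Rightarrow> 'a::euclidean_space set \<Rightarrow> ('a \<Rightarrow> 'b::real_normed_vector) \<Rightarrow> bool" where
  "Ck_on 0 S f \<longleftrightarrow> continuous_on S f"
| "Ck_on (Suc k) S f \<longleftrightarrow> (\<forall>x\<in>S. f differentiable (at x)) \<and>
     (\<forall>v. Ck_on k S (\<lambda>x. frechet_derivative f (at x) v))"

definition smooth_on :: "'a::euclidean_space set \<Rightarrow> ('a \<Rightarrow> 'b::real_normed_vector) \<Rightarrow> bool" where
  "smooth_on S f \<longleftrightarrow> (\<forall>k. Ck_on k S f)"

text \<open>A chart is a pair of a domain and a coordinate map, relevant only on that domain.\<close>

type_synonym ('m, 'n) chart = "'m set \<times> ('m \<Rightarrow> real^'n)"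

definition smooth_manifold ::
  "('m::{t2_space,second_countable_topology}, 'n::finite) chart set \<Rightarrow> bool" where
  "smooth_manifold \<A> \<longleftrightarrow>
     (\<Union>(U, \<kappa>)\<in>\<A>. U) = UNIV \<and>
     (\<forall>(U, \<kappa>)\<in>\<A>. open U \<and> open (\<kappa> ` U) \<and> homeomorphism U (\<kappa> ` U) \<kappa> (inv_into U \<kappa>)) \<and>
     (\<forall>(U, \<kappa>)\<in>\<A>. \<forall>(V, \<mu>)\<in>\<A>. smooth_on (\<kappa> ` (U \<inter> V)) (\<mu> \<circ> inv_into U \<kappa>))"

definition smooth_fun :: "('m::topological_space, 'n::finite) chart set \<Rightarrow> ('m \<Rightarrow> real) \<Rightarrow> bool" where
  "smooth_fun \<A> f \<longleftrightarrow> (\<forall>(U, \<kappa>)\<in>\<A>. smooth_on (\<kappa> ` U) (f \<circ> inv_into U \<kappa>))"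


section \<open>Vector fields and tensor fields\<close>

type_synonym 'm vfield = "('m \<Rightarrow> real) \<Rightarrow> ('m \<Rightarrow> real)"

text \<open>
  The last clause fixes the irrelevant values at non-smooth arguments, so that equality
  of vector fields is equality of functions.
\<close>

definition vector_field ::
  "('m::topological_space, 'n::finite) chart set \<Rightarrow> 'm vfield \<Rightarrow> bool" where
  "vector_field \<A> X \<longleftrightarrow>
     (\<forall>f. smooth_fun \<A> f \<longrightarrow> smooth_fun \<A> (X f)) \<and>
     (\<forall>f h. smooth_fun \<A> f \<longrightarrow> smooth_fun \<A> h \<longrightarrow> X (f + h) = X f + X h) \<and>
     (\<forall>c f. smooth_fun \<A> f \<longrightarrow> X (\<lambda>x. c * f x) = (\<lambda>x. c * X f x)) \<and>
     (\<forall>f h. smooth_fun \<A> f \<longrightarrow> smooth_fun \<A> h \<longrightarrow> X (f * h) = X f * h + f * X h) \<and>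
     (\<forall>f. \<not> smooth_fun \<A> f \<longrightarrow> X f = 0)"

abbreviation vector_fields ::
  "('m::topological_space, 'n::finite) chart set \<Rightarrow> 'm vfield set" where
  "vector_fields \<A> \<equiv> Collect (vector_field \<A>)"

definition fun_scale :: "('m \<Rightarrow> real) \<Rightarrow> 'm vfield \<Rightarrow> 'm vfield" (infixr \<open>\<cdot>\<close> 72) where
  "f \<cdot> X = (\<lambda>h. f * X h)"

definition lie :: "'m vfield \<Rightarrow> 'm vfield \<Rightarrow> 'm vfield" where
  "lie X Y = (\<lambda>h. X (Y h) - Y (X h))"

text \<open>The tangent vector at \<open>x\<close> given by a vector field.\<close>

definition val :: "'m \<Rightarrow> 'm vfield \<Rightarrow> (('m \<Rightarrow> real) \<Rightarrow> real)" where
  "val x X = (\<lambda>h. X h x)"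

definition endo_field ::
  "('m::topological_space, 'n::finite) chart set \<Rightarrow> ('m vfield \<Rightarrow> 'm vfield) \<Rightarrow> bool" where
  "endo_field \<A> \<phi> \<longleftrightarrow>
     (\<forall>X\<in>vector_fields \<A>. \<phi> X \<in> vector_fields \<A>) \<and>
     (\<forall>X\<in>vector_fields \<A>. \<forall>Y\<in>vector_fields \<A>. \<phi> (X + Y) = \<phi> X + \<phi> Y) \<and>
     (\<forall>f X. smooth_fun \<A> f \<longrightarrow> X \<in> vector_fields \<A> \<longrightarrow> \<phi> (f \<cdot> X) = f \<cdot> \<phi> X)"

definition one_form ::
  "('m::topological_space, 'n::finite) chart set \<Rightarrow> ('m vfield \<Rightarrow> 'm \<Rightarrow> real) \<Rightarrow> bool" where
  "one_form \<A> \<eta> \<longleftrightarrow>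
     (\<forall>X\<in>vector_fields \<A>. smooth_fun \<A> (\<eta> X)) \<and>
     (\<forall>X\<in>vector_fields \<A>. \<forall>Y\<in>vector_fields \<A>. \<eta> (X + Y) = \<eta> X + \<eta> Y) \<and>
     (\<forall>f X. smooth_fun \<A> f \<longrightarrow> X \<in> vector_fields \<A> \<longrightarrow> \<eta> (f \<cdot> X) = f * \<eta> X)"

definition ext_deriv :: "('m vfield \<Rightarrow> 'm \<Rightarrow> real) \<Rightarrow> 'm vfield \<Rightarrow> 'm vfield \<Rightarrow> 'm \<Rightarrow> real" where
  "ext_deriv \<eta> X Y = X (\<eta> Y) - Y (\<eta> X) - \<eta> (lie X Y)"

definition riemannian_metric ::
  "('m::topological_space, 'n::finite) chart set \<Rightarrow> ('m vfield \<Rightarrow> 'm vfield \<Rightarrow> 'm \<Rightarrow> real) \<Rightarrow> bool" where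
  "riemannian_metric \<A> g \<longleftrightarrow>
     (\<forall>X\<in>vector_fields \<A>. one_form \<A> (g X)) \<and>
     (\<forall>X\<in>vector_fields \<A>. \<forall>Y\<in>vector_fields \<A>. g X Y = g Y X) \<and>
     (\<forall>X\<in>vector_fields \<A>. \<forall>x. val x X \<noteq> 0 \<longrightarrow> g X X x > 0)"


section \<open>Connections and curvature\<close>

type_synonym 'm connection = "'m vfield \<Rightarrow> 'm vfield \<Rightarrow> 'm vfield"

definition affine_connection ::
  "('m::topological_space, 'n::finite) chart set \<Rightarrow> 'm connection \<Rightarrow> bool" where
  "affine_connection \<A> D \<longleftrightarrow>
     (\<forall>Y\<in>vector_fields \<A>. endo_field \<A> (\<lambda>X. D X Y)) \<and>
     (\<forall>X\<in>vector_fields \<A>. \<forall>Y\<in>vector_fields \<A>. \<forall>Z\<in>vector_fields \<A>.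
        D X (Y + Z) = D X Y + D X Z) \<and>
     (\<forall>f. \<forall>X\<in>vector_fields \<A>. \<forall>Y\<in>vector_fields \<A>. smooth_fun \<A> f \<longrightarrow>
        D X (f \<cdot> Y) = X f \<cdot> Y + f \<cdot> D X Y)"

definition levi_civita ::
  "('m::topological_space, 'n::finite) chart set \<Rightarrow> ('m vfield \<Rightarrow> 'm vfield \<Rightarrow> 'm \<Rightarrow> real) \<Rightarrow>
   'm connection \<Rightarrow> bool" where
  "levi_civita \<A> g D \<longleftrightarrow>
     affine_connection \<A> D \<and>
     (\<forall>X\<in>vector_fields \<A>. \<forall>Y\<in>vector_fields \<A>. D X Y - D Y X = lie X Y) \<and>
     (\<forall>X\<in>vector_fields \<A>. \<forall>Y\<in>vector_fields \<A>. \<forall>Z\<in>vector_fields \<A>.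
        X (g Y Z) = g (D X Y) Z + g Y (D X Z))"

type_synonym 'm tensor13 = "'m vfield \<Rightarrow> 'm vfield \<Rightarrow> 'm vfield \<Rightarrow> 'm vfield"

definition curvature :: "'m connection \<Rightarrow> 'm tensor13" where
  "curvature D X Y Z = D X (D Y Z) - D Y (D X Z) - D (lie X Y) Z"

text \<open>\<open>E\<close> is a family of vector fields whose values at \<open>x\<close> form a basis of the tangent space.\<close>

definition frame_at ::
  "('m::topological_space, 'n::finite) chart set \<Rightarrow> 'm \<Rightarrow> ('n \<Rightarrow> 'm vfield) \<Rightarrow> bool" where
  "frame_at \<A> x E \<longleftrightarrow>
     (\<forall>i. E i \<in> vector_fields \<A>) \<and>
     (\<forall>X\<in>vector_fields \<A>. \<exists>!c::real^'n. \<forall>h. val x X h = (\<Sum>i\<in>UNIV. c $ i * val x (E i) h))"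

text \<open>
  The trace at \<open>x\<close> of an endomorphism field \<open>F\<close>: the trace of its matrix \<open>C\<close> with respect to any basis
  of the tangent space (column \<open>j\<close> of \<open>C\<close> holds the coefficients of the image of \<open>E j\<close>).
\<close>

definition trace_at ::
  "('m::topological_space, 'n::finite) chart set \<Rightarrow> 'm \<Rightarrow> ('m vfield \<Rightarrow> 'm vfield) \<Rightarrow> real" where
  "trace_at \<A> x F = (THE t. \<exists>E (C::real^'n^'n). frame_at \<A> x E \<and>
     (\<forall>j h. val x (F (E j)) h = (\<Sum>i\<in>UNIV. C $ i $ j * val x (E i) h)) \<and> t = trace C)"

definition ricci ::
  "('m::topological_space, 'n::finite) chart set \<Rightarrow> 'm connection \<Rightarrow>
   'm vfield \<Rightarrow> 'm vfield \<Rightarrow> 'm \<Rightarrow> real" where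
  "ricci \<A> D Y Z = (\<lambda>x. trace_at \<A> x (\<lambda>X. curvature D X Y Z))"

definition einstein ::
  "('m::topological_space, 'n::finite) chart set \<Rightarrow> ('m vfield \<Rightarrow> 'm vfield \<Rightarrow> 'm \<Rightarrow> real) \<Rightarrow>
   'm connection \<Rightarrow> bool" where
  "einstein \<A> g D \<longleftrightarrow> (\<exists>c::real. \<forall>Y\<in>vector_fields \<A>. \<forall>Z\<in>vector_fields \<A>. \<forall>x.
     ricci \<A> D Y Z x = c * g Y Z x)"


section \<open>Pseudosymmetry\<close>

definition wedge ::
  "('m vfield \<Rightarrow> 'm vfield \<Rightarrow> 'm \<Rightarrow> real) \<Rightarrow> 'm vfield \<Rightarrow> 'm vfield \<Rightarrow> 'm vfield \<Rightarrow> 'm vfield" where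
  "wedge g X Y Z = g Y Z \<cdot> X - g X Z \<cdot> Y"

definition deriv_action :: "('m vfield \<Rightarrow> 'm vfield) \<Rightarrow> 'm tensor13 \<Rightarrow> 'm tensor13" where
  "deriv_action F T U V W = F (T U V W) - T (F U) V W - T U (F V) W - T U V (F W)"

definition curvature_support ::
  "('m::topological_space, 'n::finite) chart set \<Rightarrow> 'm connection \<Rightarrow> 'm set" where
  "curvature_support \<A> D = {x. \<exists>X\<in>vector_fields \<A>. \<exists>Y\<in>vector_fields \<A>. \<exists>Z\<in>vector_fields \<A>.
     val x (curvature D X Y Z) \<noteq> 0}"

definition pseudosymmetric ::
  "('m::topological_space, 'n::finite) chart set \<Rightarrow> ('m vfield \<Rightarrow> 'm vfield \<Rightarrow> 'm \<Rightarrow> real) \<Rightarrow>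
   'm connection \<Rightarrow> ('m \<Rightarrow> real) \<Rightarrow> bool" where
  "pseudosymmetric \<A> g D L \<longleftrightarrow>
     (\<forall>x\<in>curvature_support \<A> D.
      \<forall>X\<in>vector_fields \<A>. \<forall>Y\<in>vector_fields \<A>.
      \<forall>U\<in>vector_fields \<A>. \<forall>V\<in>vector_fields \<A>. \<forall>W\<in>vector_fields \<A>. \<forall>h.
        val x (deriv_action (curvature D X Y) (curvature D) U V W) h =
        L x * val x (deriv_action (wedge g X Y) (curvature D) U V W) h)"


section \<open>Para-Sasakian manifolds\<close>

definition para_sasakian ::
  "('m::topological_space, 'n::finite) chart set \<Rightarrow> ('m vfield \<Rightarrow> 'm vfield) \<Rightarrow> 'm vfield \<Rightarrow>
   ('m vfield \<Rightarrow> 'm \<Rightarrow> real) \<Rightarrow> ('m vfield \<Rightarrow> 'm vfield \<Rightarrow> 'm \<Rightarrow> real) \<Rightarrow> 'm connection \<Rightarrow> bool" where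
  "para_sasakian \<A> \<phi> \<xi> \<eta> g D \<longleftrightarrow>
     endo_field \<A> \<phi> \<and> \<xi> \<in> vector_fields \<A> \<and> one_form \<A> \<eta> \<and> riemannian_metric \<A> g \<and>
     levi_civita \<A> g D \<and>
     \<eta> \<xi> = 1 \<and> \<phi> \<xi> = 0 \<and>
     (\<forall>X\<in>vector_fields \<A>.
        \<phi> (\<phi> X) = X - \<eta> X \<cdot> \<xi> \<and> \<eta> (\<phi> X) = 0 \<and> g X \<xi> = \<eta> X \<and> D X \<xi> = \<phi> X) \<and>
     (\<forall>X\<in>vector_fields \<A>. \<forall>Y\<in>vector_fields \<A>.
        g (\<phi> X) (\<phi> Y) = g X Y - \<eta> X * \<eta> Y \<and>
        D X (\<phi> Y) - \<phi> (D X Y) = - (g X Y \<cdot> \<xi>) - \<eta> Y \<cdot> X + (2 * \<eta> X * \<eta> Y) \<cdot> \<xi> \<and>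
        ext_deriv \<eta> X Y = 0)"

definition quarter_symmetric ::
  "('m vfield \<Rightarrow> 'm vfield) \<Rightarrow> 'm vfield \<Rightarrow> ('m vfield \<Rightarrow> 'm \<Rightarrow> real) \<Rightarrow>
   ('m vfield \<Rightarrow> 'm vfield \<Rightarrow> 'm \<Rightarrow> real) \<Rightarrow> 'm connection \<Rightarrow> 'm connection" where
  "quarter_symmetric \<phi> \<xi> \<eta> g D X Y = D X Y + \<eta> Y \<cdot> \<phi> X - g (\<phi> X) Y \<cdot> \<xi>"

end

theory Submission
  imports Defs
begin

text \<open>
  The connection \<open>D\<close> is metric with torsion \<open>T(X,Y) = \<eta>(Y)\<phi>X - \<eta>(X)\<phi>Y\<close>, and its curvature \<open>R\<close> still
  satisfies the cyclic first Bianchi identity, hence pair symmetry. With \<open>W(X,Y) = X \<and> Y\<close> and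
  \<open>S = R + 2W\<close>, the formula \<open>R(X,Y)\<xi> = -2W(X,Y)\<xi>\<close> therefore gives \<open>R(\<xi>,Y) = -2W(\<xi>,Y)\<close>, so
  pseudosymmetry applied to the pair \<open>\<xi>, Y\<close> and evaluated at \<open>\<xi>\<close> becomes \<open>(L + 2) S = 0\<close>.

  If \<open>L \<noteq> -2\<close> at some point, then \<open>S = 0\<close> near that point by continuity. On such an open set the
  commutator of \<open>R(X,Y)\<close> with \<open>\<phi>\<close> and the second Bianchi identity together force \<open>|Y|\<^sup>2X = g(X,Y)Y\<close> for
  all \<open>X, Y\<close> orthogonal to \<open>\<xi>\<close>, that is, \<open>n \<le> 2\<close>. But then \<open>S = 0\<close> everywhere, because \<open>S(\<xi>,Y)\<close>
  vanishes, and taking the trace shows that the Ricci tensor is \<open>-2(n - 1)g\<close>.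
\<close>

text \<open>With vector fields as derivations of global functions, nothing local is available from
  the start. Bump functions and Hadamard's lemma supply three facts: a derivation at a point sees
  only nearby values of a function, a one-form at \<open>x\<close> depends only on the value of its
  argument at \<open>x\<close>, and tangent spaces have dimension n. Where \<open>S\<close> vanishes
  only on an open set, equations between vector fields are paired with an arbitrary \<open>P\<close>
  and read at \<open>x\<close>.

  For X, Y, Q orthogonal to \<xi> the two consequences of \<open>S = 0\<close> are g(\<phi>Y,Q)X -
  g(\<phi>X,Q)Y - g(Y,Q)\<phi>X + g(X,Q)\<phi>Y = 0 and the same equation with the signs of the last
  two terms reversed. Their sum isolates the first two terms, and Q = \<phi>Y turns the coefficients
  into g(Y,Y) and g(X,Y). The second equation owes its content to the torsion: for a torsion-free
  metric connection \<open>W\<close> satisfies the second Bianchi identity by itself.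

  Information near one point has to yield a conclusion on a manifold that may be disconnected. The
  dimension, being the same everywhere, carries it across.\<close>

section \<open>Calculus of \<open>Ck_on\<close> and \<open>smooth_on\<close>\<close>

lemma Ck_on_cong_imp:
  assumes "open S" "\<And>x. x \<in> S \<Longrightarrow> f x = g x" "Ck_on k S f"
  shows "Ck_on k S g"
  using assms(2,3)
proof (induction k arbitrary: f g)
  case 0
  then show ?case by (metis Ck_on.simps(1) continuous_on_cong)
next
  case (Suc k)
  have d: "g differentiable (at x)" "frechet_derivative f (at x) = frechet_derivative g (at x)"
    if "x \<in> S" for x
  proof -
    have "f differentiable (at x)" using Suc that by simp
    then have f: "(f has_derivative frechet_derivative f (at x)) (at x)"
      using frechet_derivative_works by blast
    have "(g has_derivative frechet_derivative f (at x)) (at x)"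
      by (rule has_derivative_transform_within_open[OF f \<open>open S\<close> that]) (use Suc in auto)
    then show "g differentiable (at x)" "frechet_derivative f (at x) = frechet_derivative g (at x)"
      by (auto simp: differentiable_def intro: frechet_derivative_at)
  qed
  then show ?case
    using Suc.prems Suc.IH by (simp, metis (no_types, lifting))
qed

lemma Ck_on_cong:
  assumes "open S" "\<And>x. x \<in> S \<Longrightarrow> f x = g x"
  shows "Ck_on k S f \<longleftrightarrow> Ck_on k S g"
  using Ck_on_cong_imp[OF assms(1)] assms(2) by metis

lemma Ck_on_subset: "Ck_on k S f \<Longrightarrow> T \<subseteq> S \<Longrightarrow> Ck_on k T f"
  by (induction k arbitrary: f) (auto intro: continuous_on_subset)

lemma Ck_on_SucD: "Ck_on (Suc k) S f \<Longrightarrow> Ck_on k S f"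
proof (induction k arbitrary: f)
  case 0
  then show ?case
    by (auto intro!: continuous_at_imp_continuous_on differentiable_imp_continuous_within)
next
  case (Suc k)
  then show ?case by (metis Ck_on.simps(2))
qed

lemma Ck_on_local:
  assumes "\<And>x. x \<in> S \<Longrightarrow> \<exists>T. open T \<and> x \<in> T \<and> Ck_on k T f"
  shows "Ck_on k S f"
  using assms
proof (induction k arbitrary: f)
  case 0
  then show ?case
    by (fastforce intro!: continuous_at_imp_continuous_on simp: continuous_on_eq_continuous_at)
next
  case (Suc k)
  then show ?case by (simp, meson)
qed

lemma Ck_on_has_derivative:
  "Ck_on (Suc k) S f \<Longrightarrow> x \<in> S \<Longrightarrow> (f has_derivative frechet_derivative f (at x)) (at x)"
  by (simp add: frechet_derivative_works[symmetric])

lemma Ck_on_const: "Ck_on k S (\<lambda>x. c)"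
proof (induction k arbitrary: c)
  case (Suc k)
  then show ?case by simp
qed simp

lemma Ck_on_linear: "bounded_linear f \<Longrightarrow> Ck_on k S f"
proof (cases k)
  case 0
  then show "bounded_linear f \<Longrightarrow> ?thesis" by (simp add: linear_continuous_on)
next
  case (Suc n)
  assume f: "bounded_linear f"
  have "frechet_derivative f (at x) = f" for x
    using f bounded_linear_imp_has_derivative frechet_derivative_at by metis
  then show ?thesis using Suc f
    by (auto intro: Ck_on_const bounded_linear_imp_differentiable)
qed

lemma Ck_on_bounded_linear:
  assumes "open S" "bounded_linear l" "Ck_on k S f"
  shows "Ck_on k S (\<lambda>x. l (f x))"
  using assms(3)
proof (induction k arbitrary: f)
  case 0
  then show ?case
    using assms(2) by (auto intro: bounded_linear.continuous_on)
next
  case (Suc k)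
  have d: "((\<lambda>x. l (f x)) has_derivative (\<lambda>v. l (frechet_derivative f (at x) v))) (at x)"
    if "x \<in> S" for x
    by (intro bounded_linear.has_derivative[OF assms(2)] Ck_on_has_derivative[OF Suc.prems that])
  have "Ck_on k S (\<lambda>x. frechet_derivative (\<lambda>x. l (f x)) (at x) v)" for v
  proof (rule Ck_on_cong_imp[OF \<open>open S\<close>])
    show "Ck_on k S (\<lambda>x. l (frechet_derivative f (at x) v))"
      using Suc by simp
    show "l (frechet_derivative f (at x) v) = frechet_derivative (\<lambda>x. l (f x)) (at x) v"
      if "x \<in> S" for x using frechet_derivative_at[OF d[OF that]] by metis
  qed
  then show ?case using differentiableI[OF d] by simp
qed

lemma Ck_on_add:
  assumes "open S" "Ck_on k S f" "Ck_on k S g"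
  shows "Ck_on k S (\<lambda>x. f x + g x)"
  using assms(2,3)
proof (induction k arbitrary: f g)
  case 0
  then show ?case by (simp add: continuous_on_add)
next
  case (Suc k)
  have d: "((\<lambda>x. f x + g x) has_derivative
     (\<lambda>v. frechet_derivative f (at x) v + frechet_derivative g (at x) v)) (at x)"
    if "x \<in> S" for x
    by (intro has_derivative_add Ck_on_has_derivative[OF Suc.prems(1) that] Ck_on_has_derivative[OF Suc.prems(2) that])
  have "Ck_on k S (\<lambda>x. frechet_derivative (\<lambda>x. f x + g x) (at x) v)" for v
  proof (rule Ck_on_cong_imp[OF \<open>open S\<close>])
    show "Ck_on k S (\<lambda>x. frechet_derivative f (at x) v + frechet_derivative g (at x) v)"
      using Suc by simp
    show "frechet_derivative f (at x) v + frechet_derivative g (at x) v =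
       frechet_derivative (\<lambda>x. f x + g x) (at x) v"
      if "x \<in> S" for x using frechet_derivative_at[OF d[OF that]] by metis
  qed
  then show ?case using differentiableI[OF d] by simp
qed

lemma Ck_on_sum:
  assumes "open S" "finite I" "\<And>i. i \<in> I \<Longrightarrow> Ck_on k S (f i)"
  shows "Ck_on k S (\<lambda>x. \<Sum>i\<in>I. f i x)"
  using assms(2,3) by (induction rule: finite_induct) (auto intro: Ck_on_add assms(1) Ck_on_const)

lemma Ck_on_mult:
  fixes f g :: "'a::euclidean_space \<Rightarrow> real"
  assumes "open S" "Ck_on k S f" "Ck_on k S g"
  shows "Ck_on k S (\<lambda>x. f x * g x)"
  using assms(2,3)
proof (induction k arbitrary: f g)
  case 0
  then show ?case by (simp add: continuous_on_mult)
next
  case (Suc k)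
  note fg = Suc.prems[THEN Ck_on_SucD]
  have d: "((\<lambda>x. f x * g x) has_derivative
     (\<lambda>v. f x * frechet_derivative g (at x) v + frechet_derivative f (at x) v * g x)) (at x)"
    if "x \<in> S" for x
    by (intro has_derivative_mult Ck_on_has_derivative[OF Suc.prems(1) that] Ck_on_has_derivative[OF Suc.prems(2) that])
  have "Ck_on k S (\<lambda>x. frechet_derivative (\<lambda>x. f x * g x) (at x) v)" for v
  proof (rule Ck_on_cong_imp[OF \<open>open S\<close>])
    show "Ck_on k S (\<lambda>x. f x * frechet_derivative g (at x) v + frechet_derivative f (at x) v * g x)"
      using Suc.prems fg by (intro Ck_on_add[OF \<open>open S\<close>] Suc.IH) auto
    show "f x * frechet_derivative g (at x) v + frechet_derivative f (at x) v * g x =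
       frechet_derivative (\<lambda>x. f x * g x) (at x) v"
      if "x \<in> S" for x using frechet_derivative_at[OF d[OF that]] by metis
  qed
  then show ?case using differentiableI[OF d] by simp
qed

text \<open>The chain rule, expanded over \<open>Basis\<close>, presents the derivative as a sum of
  products of a component of the derivative of \<open>f\<close> with a partial derivative of
  \<open>g\<close> composed with \<open>f\<close>. The induction therefore generalises over
  \<open>g\<close>, which its partial derivatives replace, while \<open>f\<close> merely drops from
  order k + 1 to k.\<close>

lemma Ck_on_compose:
  fixes g :: "'b::euclidean_space \<Rightarrow> real"
  assumes "open S" "open T" "f ` S \<subseteq> T" "Ck_on k S f" "Ck_on k T g"
  shows "Ck_on k S (\<lambda>x. g (f x))"
  using assms(4,5)
proof (induction k arbitrary: g)
  case 0
  then show ?case using assms(3) by (auto intro: continuous_on_compose2)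
next
  case (Suc k)
  let ?D = "\<lambda>x v. \<Sum>b\<in>Basis. (frechet_derivative f (at x) v \<bullet> b) * frechet_derivative g (at (f x)) b"
  have d: "((\<lambda>x. g (f x)) has_derivative ?D x) (at x)" if "x \<in> S" for x
  proof -
    have "g differentiable (at (f x))"
      using Suc.prems that assms(3) by auto
    then have lin: "linear (frechet_derivative g (at (f x)))"
      by (simp add: linear_frechet_derivative)
    have "frechet_derivative g (at (f x)) w = (\<Sum>b\<in>Basis. (w \<bullet> b) * frechet_derivative g (at (f x)) b)" for w
    proof -
      have "frechet_derivative g (at (f x)) w
        = frechet_derivative g (at (f x)) (\<Sum>b\<in>Basis. (w \<bullet> b) *\<^sub>R b)"
        by (simp add: euclidean_representation)
      also have "\<dots> = (\<Sum>b\<in>Basis. (w \<bullet> b) * frechet_derivative g (at (f x)) b)"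
        by (simp add: linear_sum[OF lin] linear_cmul[OF lin])
      finally show ?thesis .
    qed
    then have *: "(\<lambda>v. frechet_derivative g (at (f x)) (frechet_derivative f (at x) v)) = ?D x"
      by (rule ext)
    have "f x \<in> T" using that assms(3) by auto
    from Ck_on_has_derivative[OF Suc.prems(1) that] Ck_on_has_derivative[OF Suc.prems(2) this]
    have "((\<lambda>x. g (f x)) has_derivative
      (\<lambda>v. frechet_derivative g (at (f x)) (frechet_derivative f (at x) v))) (at x)"
      by (rule has_derivative_compose)
    then show ?thesis unfolding * .
  qed
  have "Ck_on k S (\<lambda>x. frechet_derivative (\<lambda>x. g (f x)) (at x) v)" for v
  proof (rule Ck_on_cong_imp[OF \<open>open S\<close>])
    show "Ck_on k S (\<lambda>x. ?D x v)"
    proof (intro Ck_on_sum[OF \<open>open S\<close>] Ck_on_mult[OF \<open>open S\<close>] finite_Basis)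
      fix b :: 'b
      have "Ck_on k S (\<lambda>x. frechet_derivative f (at x) v)" using Suc.prems by simp
      then show "Ck_on k S (\<lambda>x. frechet_derivative f (at x) v \<bullet> b)"
        by (rule Ck_on_bounded_linear[OF \<open>open S\<close> bounded_linear_inner_left])
      have "Ck_on k T (\<lambda>y. frechet_derivative g (at y) b)" using Suc.prems by simp
      then show "Ck_on k S (\<lambda>x. frechet_derivative g (at (f x)) b)"
        by (rule Suc.IH[OF Ck_on_SucD[OF Suc.prems(1)]])
    qed
    show "?D x v = frechet_derivative (\<lambda>x. g (f x)) (at x) v" if "x \<in> S" for x
      using frechet_derivative_at[OF d[OF that]] by metis
  qed
  then show ?case using differentiableI[OF d] by simp
qed

lemma smooth_on_cong:
  "open S \<Longrightarrow> (\<And>x. x \<in> S \<Longrightarrow> f x = g x) \<Longrightarrow> smooth_on S f \<longleftrightarrow> smooth_on S g"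
  unfolding smooth_on_def using Ck_on_cong by metis

lemma smooth_on_subset: "smooth_on S f \<Longrightarrow> T \<subseteq> S \<Longrightarrow> smooth_on T f"
  unfolding smooth_on_def using Ck_on_subset by metis

lemma smooth_on_local:
  assumes "\<And>x. x \<in> S \<Longrightarrow> \<exists>T. open T \<and> x \<in> T \<and> smooth_on T f"
  shows "smooth_on S f"
  using assms unfolding smooth_on_def by (meson Ck_on_local)

lemma smooth_on_const: "smooth_on S (\<lambda>x. c)"
  by (simp add: smooth_on_def Ck_on_const)

lemma smooth_on_linear: "bounded_linear f \<Longrightarrow> smooth_on S f"
  by (simp add: smooth_on_def Ck_on_linear)

lemma smooth_on_add:
  "open S \<Longrightarrow> smooth_on S f \<Longrightarrow> smooth_on S g \<Longrightarrow> smooth_on S (\<lambda>x. f x + g x)"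
  by (simp add: smooth_on_def Ck_on_add)

lemma smooth_on_mult:
  fixes f g :: "'a::euclidean_space \<Rightarrow> real"
  shows "open S \<Longrightarrow> smooth_on S f \<Longrightarrow> smooth_on S g \<Longrightarrow> smooth_on S (\<lambda>x. f x * g x)"
  by (simp add: smooth_on_def Ck_on_mult)

lemma smooth_on_sum:
  "open S \<Longrightarrow> finite I \<Longrightarrow> (\<And>i. i \<in> I \<Longrightarrow> smooth_on S (f i)) \<Longrightarrow> smooth_on S (\<lambda>x. \<Sum>i\<in>I. f i x)"
  by (simp add: smooth_on_def Ck_on_sum)

lemma smooth_on_compose:
  fixes g :: "'b::euclidean_space \<Rightarrow> real"
  assumes "open S" "open T" "f ` S \<subseteq> T" "smooth_on S f" "smooth_on T g"
  shows "smooth_on S (\<lambda>x. g (f x))"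
  using assms Ck_on_compose[OF assms(1-3)] unfolding smooth_on_def by blast

lemma smooth_on_differentiable: "smooth_on S f \<Longrightarrow> x \<in> S \<Longrightarrow> f differentiable (at x)"
  unfolding smooth_on_def by (metis Ck_on.simps(2))

lemma smooth_on_derivative: "smooth_on S f \<Longrightarrow> smooth_on S (\<lambda>x. frechet_derivative f (at x) v)"
  unfolding smooth_on_def by (metis Ck_on.simps(2))

lemma smooth_on_continuous: "smooth_on S f \<Longrightarrow> continuous_on S f"
  unfolding smooth_on_def by (metis Ck_on.simps(1))


section \<open>Bump functions\<close>

text \<open>The powers of 1/t make the family closed under differentiation up to linear
  combinations. Smoothness of exp(-1/t) then follows by one induction that treats all
  \<open>m\<close> at once.\<close>

definition flat :: "nat \<Rightarrow> real \<Rightarrow> real" where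
  "flat m t = (if t > 0 then exp (- inverse t) * inverse t ^ m else 0)"

lemma flat_at_0: "(flat m \<longlongrightarrow> 0) (at 0)"
proof -
  have "((\<lambda>s::real. s ^ m / exp s) \<longlongrightarrow> 0) at_top"
    by (rule tendsto_power_div_exp_0)
  then have "((\<lambda>t::real. inverse t ^ m / exp (inverse t)) \<longlongrightarrow> 0) (at_right 0)"
    by (rule filterlim_compose[OF _ filterlim_inverse_at_top_right])
  then have r: "(flat m \<longlongrightarrow> 0) (at_right 0)"
    by (rule Lim_transform_eventually)
      (auto simp: eventually_at_filter flat_def exp_minus field_simps)
  have l: "(flat m \<longlongrightarrow> 0) (at_left 0)"
    by (rule Lim_transform_eventually[OF tendsto_const])
      (auto simp: eventually_at_filter flat_def)
  show ?thesis using l r by (simp add: filterlim_split_at)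
qed

lemma flat_has_derivative:
  "(flat m has_real_derivative (flat (m + 2) t - m * flat (m + 1) t)) (at t)"
proof -
  consider "t > 0" | "t < 0" | "t = 0" by linarith
  then show ?thesis
  proof cases
    case 1
    have i: "(inverse has_real_derivative - (inverse t ^ Suc (Suc 0))) (at t)"
      using 1 by (intro DERIV_inverse) simp
    have "((\<lambda>t. exp (- inverse t) * inverse t ^ m) has_real_derivative
      exp (- inverse t) * (- (- (inverse t ^ Suc (Suc 0)))) * inverse t ^ m
      + m * (- (inverse t ^ Suc (Suc 0)) * inverse t ^ (m - Suc 0)) * exp (- inverse t)) (at t)"
      by (intro DERIV_mult DERIV_chain2[where f=exp] DERIV_exp DERIV_minus i DERIV_power)
    moreover have "exp (- inverse t) * (- (- (inverse t ^ Suc (Suc 0)))) * inverse t ^ m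
      + m * (- (inverse t ^ Suc (Suc 0)) * inverse t ^ (m - Suc 0)) * exp (- inverse t)
      = flat (m + 2) t - m * flat (m + 1) t"
      using 1 by (cases m) (simp_all add: flat_def algebra_simps)
    ultimately have "((\<lambda>t. exp (- inverse t) * inverse t ^ m) has_real_derivative
      (flat (m + 2) t - m * flat (m + 1) t)) (at t)"
      by (simp only:)
    then show ?thesis
      by (rule has_field_derivative_transform_within_open[of _ _ _ "{0<..}"])
        (use 1 in \<open>auto simp: flat_def\<close>)
  next
    case 2
    have "((\<lambda>t. 0) has_real_derivative (flat (m + 2) t - m * flat (m + 1) t)) (at t)"
      using 2 by (auto simp: flat_def)
    then show ?thesis
      by (rule has_field_derivative_transform_within_open[of _ _ _ "{..<0}"])
        (use 2 in \<open>auto simp: flat_def\<close>)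
  next
    case 3
    \<comment> \<open>Away from 0 the difference quotient of \<open>flat m\<close> at 0 is
      \<open>flat (Suc m)\<close>, whose limit is already known.\<close>
    have "((\<lambda>h. flat m h / h) \<longlongrightarrow> 0) (at 0)"
      by (rule Lim_transform_eventually[OF flat_at_0[of "Suc m"]])
        (auto simp: eventually_at_filter flat_def field_simps)
    then show ?thesis using 3
      by (simp add: DERIV_def flat_def)
  qed
qed

lemma smooth_on_flat: "smooth_on S (flat m)"
proof -
  have "Ck_on k UNIV (flat m)" for k
  proof (induction k arbitrary: m)
    case 0
    show ?case
      by (auto intro!: continuous_at_imp_continuous_on DERIV_isCont[OF flat_has_derivative])
  next
    case (Suc k)
    have d: "(flat m has_derivative (\<lambda>v. (flat (m + 2) t - m * flat (m + 1) t) * v)) (at t)" for t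
      using flat_has_derivative by (simp add: has_field_derivative_def)
    have "frechet_derivative (flat m) (at t) v = (flat (m + 2) t + (- real m) * flat (m + 1) t) * v" for t v
      using frechet_derivative_at[OF d[of t], symmetric] by simp
    moreover have "Ck_on k UNIV (\<lambda>t. (flat (m + 2) t + (- real m) * flat (m + 1) t) * v)" for v
      by (intro Ck_on_mult Ck_on_add Ck_on_const Suc) auto
    moreover have "flat m differentiable (at t)" for t
      using d[of t] by (rule differentiableI)
    ultimately show ?case by simp
  qed
  then show ?thesis unfolding smooth_on_def using Ck_on_subset[OF _ subset_UNIV] by blast
qed

text \<open>The argument of \<open>flat 0\<close> is a polynomial in the coordinates, hence smooth,
  and it is positive exactly on the open ball of radius \<open>r\<close> about
  \<open>p\<close>.\<close>

definition bump :: "'a::euclidean_space \<Rightarrow> real \<Rightarrow> 'a \<Rightarrow> real" where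
  "bump p r y = flat 0 (r\<^sup>2 - (y - p) \<bullet> (y - p))"

lemma bump_nonzero_iff: "r > 0 \<Longrightarrow> bump p r y \<noteq> 0 \<longleftrightarrow> y \<in> ball p r"
proof -
  assume r: "r > 0"
  have "bump p r y \<noteq> 0 \<longleftrightarrow> (dist y p)\<^sup>2 < r\<^sup>2"
    by (simp add: bump_def flat_def dist_norm power2_norm_eq_inner)
  also have "\<dots> \<longleftrightarrow> dist y p < r"
    using r power2_less_imp_less[of "dist y p" r] power_strict_mono[of "dist y p" r 2] by auto
  finally show ?thesis by (simp add: dist_commute)
qed

lemma smooth_on_bump: "smooth_on S (bump p r)"
proof -
  have "smooth_on UNIV (\<lambda>y::'a. r\<^sup>2 + (\<Sum>b\<in>Basis. (- 1) * ((y \<bullet> b + - (p \<bullet> b)) * (y \<bullet> b + - (p \<bullet> b)))))"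
    by (intro smooth_on_add smooth_on_sum smooth_on_mult smooth_on_const smooth_on_linear
          bounded_linear_inner_left) auto
  then have "smooth_on UNIV (\<lambda>y::'a. flat 0 (r\<^sup>2 + (\<Sum>b\<in>Basis. (- 1) * ((y \<bullet> b + - (p \<bullet> b)) * (y \<bullet> b + - (p \<bullet> b))))))"
    by (intro smooth_on_compose[where T=UNIV and g="flat 0", OF _ _ _ _ smooth_on_flat]) auto
  moreover have "(\<lambda>y::'a. flat 0 (r\<^sup>2 + (\<Sum>b\<in>Basis. (- 1) * ((y \<bullet> b + - (p \<bullet> b)) * (y \<bullet> b + - (p \<bullet> b)))))) = bump p r"
  proof
    fix y
    have "(y - p) \<bullet> (y - p) = (\<Sum>b\<in>Basis. (y \<bullet> b - p \<bullet> b) * (y \<bullet> b - p \<bullet> b))"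
      by (subst euclidean_inner) (simp only: inner_diff_left)
    then show "flat 0 (r\<^sup>2 + (\<Sum>b\<in>Basis. (- 1) * ((y \<bullet> b + - (p \<bullet> b)) * (y \<bullet> b + - (p \<bullet> b))))) = bump p r y"
      by (simp add: bump_def sum_negf)
  qed
  ultimately have "smooth_on UNIV (bump p r)" by (simp only:)
  then show ?thesis by (rule smooth_on_subset) simp
qed


section \<open>Hadamard's lemma\<close>

text \<open>Differentiating under the integral in \<open>y\<close> produces a factor
  \<open>t\<close> from the inner map and replaces \<open>F\<close> by a directional derivative. The
  weight \<open>t ^ m\<close> is there to absorb these factors, so the induction runs over
  \<open>F\<close> and \<open>m\<close> together.\<close>

lemma Ck_on_ray_integral:
  fixes F :: "'a::euclidean_space \<Rightarrow> real"
  assumes S: "open S" "convex S" "p \<in> S" and "Ck_on k S F"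
  shows "Ck_on k (S) (\<lambda>y. integral {0..1} (\<lambda>t. t ^ m * F (p + t *\<^sub>R (y - p))))"
  using assms(4)
proof (induction k arbitrary: F m)
  case 0
  have *: "p + t *\<^sub>R (y - p) \<in> S" if "y \<in> S" "t \<in> {0..1}" for y t
    using that convexD_alt[OF S(2,3), of y t] by (simp add: algebra_simps)
  have "continuous_on (S) (\<lambda>y. integral (cbox 0 1) (\<lambda>t. t ^ m * F (p + t *\<^sub>R (y - p))))"
  proof (rule integral_continuous_on_param)
    have "continuous_on (S \<times> cbox 0 (1::real)) (\<lambda>z. F (p + snd z *\<^sub>R (fst z - p)))"
      by (rule continuous_on_compose2[where t="S" and g=F])
        (use 0 * in \<open>auto intro!: continuous_intros\<close>)
    then show "continuous_on (S \<times> cbox 0 (1::real)) (\<lambda>(y, t). t ^ m * F (p + t *\<^sub>R (y - p)))"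
      by (auto simp: case_prod_beta intro!: continuous_intros)
  qed
  then show ?case by simp
next
  case (Suc k)
  let ?D = "\<lambda>y. frechet_derivative F (at y)"
  let ?J = "\<lambda>m F y. integral {0..1} (\<lambda>t. t ^ m * F (p + t *\<^sub>R (y - p)))"
  have ray: "p + t *\<^sub>R (y - p) \<in> S" if "y \<in> S" "t \<in> {0..1}" for y t
    using that convexD_alt[OF S(2,3), of y t] by (simp add: algebra_simps)
  have Dc: "continuous_on S (\<lambda>y. ?D y v)" for v
  proof -
    have "Ck_on 0 S (\<lambda>y. ?D y v)"
    proof -
      have "Ck_on j S h \<Longrightarrow> Ck_on 0 S h" for j and h :: "'a \<Rightarrow> real"
        by (induction j) (auto dest: Ck_on_SucD simp del: Ck_on.simps)
      then show ?thesis using Suc.prems by auto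
    qed
    then show ?thesis by simp
  qed
  have Fc: "continuous_on S F"
    using Suc.prems by (auto intro!: continuous_at_imp_continuous_on differentiable_imp_continuous_within)
  have DF: "(F has_derivative ?D y) (at y)" if "y \<in> S" for y
    by (rule Ck_on_has_derivative[OF Suc.prems that])
  have rep: "?D y v = (\<Sum>b\<in>Basis. (v \<bullet> b) * ?D y b)" if "y \<in> S" for y v
  proof -
    have lin: "linear (?D y)" using DF[OF that] has_derivative_linear by blast
    have "?D y v = ?D y (\<Sum>b\<in>Basis. (v \<bullet> b) *\<^sub>R b)" by (simp add: euclidean_representation)
    also have "\<dots> = (\<Sum>b\<in>Basis. (v \<bullet> b) * ?D y b)"
      by (simp add: linear_sum[OF lin] linear_cmul[OF lin])
    finally show ?thesis .
  qed
  have Dray: "continuous_on (S \<times> cbox 0 (1::real)) (\<lambda>z. ?D (p + snd z *\<^sub>R (fst z - p)) v)" for v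
    by (rule continuous_on_compose2[where t="S" and g="\<lambda>y. ?D y v"])
      (use Dc ray in \<open>auto intro!: continuous_intros\<close>)
  \<comment> \<open>The Leibniz rule asks for a derivative that is jointly continuous as a bounded
    linear map; in a basis this reduces to continuity of the directional derivatives along the
    rays.\<close>
  define fx where "fx y t = (\<Sum>b\<in>Basis. (t ^ Suc m * ?D (p + t *\<^sub>R (y - p)) b) *\<^sub>R blinfun_inner_left b)"
    for y :: 'a and t :: real
  have fxD: "blinfun_apply (fx y t) v = t ^ m * ?D (p + t *\<^sub>R (y - p)) (t *\<^sub>R v)"
    if "y \<in> S" "t \<in> {0..1}" for y t v
    unfolding fx_def
    by (subst rep[OF ray[OF that]])
      (simp add: blinfun.sum_left blinfun.scaleR_left sum_distrib_left inner_commute mult_ac)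
  have D: "((\<lambda>y. ?J m F y) has_derivative (\<lambda>v. ?J (Suc m) (\<lambda>y. ?D y v) y)) (at y)"
    if y: "y \<in> S" for y
  proof -
    have "((\<lambda>y. integral (cbox 0 1) (\<lambda>t. t ^ m * F (p + t *\<^sub>R (y - p)))) has_derivative
       blinfun_apply (integral (cbox 0 1) (fx y))) (at y within S)"
    proof (rule leibniz_rule[where U="S"])
      show "((\<lambda>y. t ^ m * F (p + t *\<^sub>R (y - p))) has_derivative blinfun_apply (fx y t)) (at y within S)"
        if "y \<in> S" "t \<in> cbox 0 1" for y and t :: real
      proof -
        have "((\<lambda>y. p + t *\<^sub>R (y - p)) has_derivative (\<lambda>v. t *\<^sub>R v)) (at y within S)"
          by (auto intro!: derivative_eq_intros)
        then have "((\<lambda>y. F (p + t *\<^sub>R (y - p))) has_derivative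
            (\<lambda>v. ?D (p + t *\<^sub>R (y - p)) (t *\<^sub>R v))) (at y within S)"
          by (rule has_derivative_compose) (use DF ray that in auto)
        then have "((\<lambda>y. t ^ m * F (p + t *\<^sub>R (y - p))) has_derivative
            (\<lambda>v. t ^ m * ?D (p + t *\<^sub>R (y - p)) (t *\<^sub>R v))) (at y within S)"
          by (rule has_derivative_mult_right)
        moreover have "blinfun_apply (fx y t) = (\<lambda>v. t ^ m * ?D (p + t *\<^sub>R (y - p)) (t *\<^sub>R v))"
          using fxD that by auto
        ultimately show ?thesis by simp
      qed
      show "(\<lambda>t. t ^ m * F (p + t *\<^sub>R (y - p))) integrable_on cbox 0 1" if "y \<in> S" for y
      proof (rule integrable_continuous)
        have "continuous_on (cbox 0 1) (\<lambda>t. F (p + t *\<^sub>R (y - p)))"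
          by (rule continuous_on_compose2[OF Fc]) (use ray that in \<open>auto intro!: continuous_intros\<close>)
        then show "continuous_on (cbox 0 1) (\<lambda>t. t ^ m * F (p + t *\<^sub>R (y - p)))"
          by (auto intro!: continuous_intros)
      qed
      show "continuous_on (S \<times> cbox 0 1) (\<lambda>(y, t). fx y t)"
        unfolding fx_def case_prod_beta by (intro continuous_intros Dray)
    qed (use y S in auto)
    moreover have "blinfun_apply (integral (cbox 0 1) (fx y)) v = ?J (Suc m) (\<lambda>y. ?D y v) y" for v
    proof -
      have c: "continuous_on (cbox 0 1) (\<lambda>t. ?D (p + t *\<^sub>R (y - p)) v)" for v
        by (rule continuous_on_compose2[OF Dc[of v]]) (use ray y in \<open>auto intro!: continuous_intros\<close>)
      then have "fx y integrable_on cbox 0 1"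
        unfolding fx_def by (intro integrable_continuous continuous_intros)
      then have "blinfun_apply (integral (cbox 0 1) (fx y)) v = integral (cbox 0 1) (\<lambda>t. blinfun_apply (fx y t) v)"
        using integral_linear[OF _ bounded_linear_blinfun_apply[OF bounded_linear_ident], of "fx y" "cbox 0 1"]
        by (smt (verit, best) blinfun.bounded_linear_left integral_linear o_def integral_cong)
      also have "\<dots> = integral (cbox 0 1) (\<lambda>t. t ^ Suc m * ?D (p + t *\<^sub>R (y - p)) v)"
      proof (rule integral_cong)
        fix t :: real assume t: "t \<in> cbox 0 1"
        have "linear (?D (p + t *\<^sub>R (y - p)))"
          using DF[OF ray] y t has_derivative_linear by fastforce
        then show "blinfun_apply (fx y t) v = t ^ Suc m * ?D (p + t *\<^sub>R (y - p)) v"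
          using fxD[OF y] t by (simp add: linear_cmul)
      qed
      finally show ?thesis by simp
    qed
    then have "blinfun_apply (integral (cbox 0 1) (fx y)) = (\<lambda>v. ?J (Suc m) (\<lambda>y. ?D y v) y)"
      by (rule ext)
    ultimately show ?thesis
      using at_within_open[OF y \<open>open S\<close>] by (simp only: cbox_interval)
  qed
  have "Ck_on k S (\<lambda>y. frechet_derivative (?J m F) (at y) v)" for v
  proof (rule Ck_on_cong_imp[OF \<open>open S\<close>])
    show "Ck_on k S (?J (Suc m) (\<lambda>y. ?D y v))"
      by (rule Suc.IH) (use Suc.prems in simp)
    show "?J (Suc m) (\<lambda>y. ?D y v) y = frechet_derivative (?J m F) (at y) v" if "y \<in> S" for y
      using frechet_derivative_at[OF D[OF that]] by metis
  qed
  then show ?case using differentiableI[OF D] by simp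
qed

text \<open>The difference \<open>F y - F p\<close> is the integral of the derivative along the
  segment from \<open>p\<close> to \<open>y\<close>, which convexity keeps inside \<open>S\<close>.
  Each \<open>G i\<close> averages the i-th partial derivative over the segment; for
  \<open>y = p\<close> the average is over a constant. It is smooth as the ray integral with weight
  \<open>t ^ 0\<close>.\<close>

lemma Hadamard:
  fixes F :: "real^'n \<Rightarrow> real"
  assumes S: "open S" "convex S" "p \<in> S" and F: "smooth_on S F"
  obtains G where "\<And>i. smooth_on (S) (G i)"
    "\<And>y. y \<in> S \<Longrightarrow> F y = F p + (\<Sum>i\<in>UNIV. (y $ i - p $ i) * G i y)"
    "\<And>i. G i p = frechet_derivative F (at p) (axis i 1)"
proof
  let ?G = "\<lambda>i y. integral {0..1} (\<lambda>t. t ^ 0 * frechet_derivative F (at (p + t *\<^sub>R (y - p))) (axis i 1))"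
  show "smooth_on (S) (?G i)" for i
    using smooth_on_derivative[OF F, of "axis i 1"] unfolding smooth_on_def
    by (intro allI Ck_on_ray_integral S) auto
  show "?G i p = frechet_derivative F (at p) (axis i 1)" for i by simp
  show "F y = F p + (\<Sum>i\<in>UNIV. (y $ i - p $ i) * ?G i y)" if y: "y \<in> S" for y
  proof -
    let ?D = "\<lambda>y. frechet_derivative F (at y)"
    have ray: "p + t *\<^sub>R (y - p) \<in> S" if "t \<in> {0..1}" for t
      using that y convexD_alt[OF S(2,3), of y t] by (simp add: algebra_simps)
    have der: "((\<lambda>t. F (p + t *\<^sub>R (y - p))) has_vector_derivative
        (\<Sum>i\<in>UNIV. (y $ i - p $ i) * ?D (p + t *\<^sub>R (y - p)) (axis i 1))) (at t within {0..1})"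
      if "t \<in> {0..1}" for t
    proof -
      have FD: "(F has_derivative ?D (p + t *\<^sub>R (y - p))) (at (p + t *\<^sub>R (y - p)))"
        using smooth_on_differentiable[OF F ray[OF that]] frechet_derivative_works by blast
      have lin: "linear (?D (p + t *\<^sub>R (y - p)))" using FD has_derivative_linear by blast
      have "((\<lambda>t. p + t *\<^sub>R (y - p)) has_derivative (\<lambda>s. s *\<^sub>R (y - p))) (at t within {0..1})"
        by (auto intro!: derivative_eq_intros)
      then have "((\<lambda>t. F (p + t *\<^sub>R (y - p))) has_derivative
          (\<lambda>s. ?D (p + t *\<^sub>R (y - p)) (s *\<^sub>R (y - p)))) (at t within {0..1})"
        by (rule has_derivative_compose) (rule FD)
      moreover have "?D (p + t *\<^sub>R (y - p)) (y - p) =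
         (\<Sum>i\<in>UNIV. (y $ i - p $ i) * ?D (p + t *\<^sub>R (y - p)) (axis i 1))"
      proof -
        have "?D (p + t *\<^sub>R (y - p)) (y - p) = ?D (p + t *\<^sub>R (y - p)) (\<Sum>i\<in>UNIV. (y - p) $ i *\<^sub>R axis i 1)"
          by (simp only: scalar_mult_eq_scaleR[symmetric] basis_expansion)
        then show ?thesis by (simp add: linear_sum[OF lin] linear_cmul[OF lin])
      qed
      ultimately show ?thesis
        by (simp add: has_vector_derivative_def linear_cmul[OF lin])
    qed
    have "((\<lambda>t. \<Sum>i\<in>UNIV. (y $ i - p $ i) * ?D (p + t *\<^sub>R (y - p)) (axis i 1))
        has_integral F (p + 1 *\<^sub>R (y - p)) - F (p + 0 *\<^sub>R (y - p))) {0..1}"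
      by (rule fundamental_theorem_of_calculus[OF _ der]) auto
    then have "integral {0..1} (\<lambda>t. \<Sum>i\<in>UNIV. (y $ i - p $ i) * ?D (p + t *\<^sub>R (y - p)) (axis i 1)) = F y - F p"
      by (simp add: integral_unique)
    moreover have "integral {0..1} (\<lambda>t. \<Sum>i\<in>UNIV. (y $ i - p $ i) * ?D (p + t *\<^sub>R (y - p)) (axis i 1))
       = (\<Sum>i\<in>UNIV. (y $ i - p $ i) * ?G i y)"
    proof -
      have c: "continuous_on {0..1} (\<lambda>t. ?D (p + t *\<^sub>R (y - p)) (axis i 1))" for i
        by (rule continuous_on_compose2[OF smooth_on_continuous[OF smooth_on_derivative[OF F]]])
          (use ray in \<open>auto intro!: continuous_intros\<close>)
      show ?thesis
        by (subst integral_sum) (auto intro!: integrable_continuous_interval continuous_intros c)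
    qed
    ultimately show ?thesis by simp
  qed
qed


section \<open>Smooth functions on a manifold\<close>

definition extend_zero ::
  "'m set \<Rightarrow> ('m \<Rightarrow> real^'n) \<Rightarrow> (real^'n \<Rightarrow> real) \<Rightarrow> 'm \<Rightarrow> real" where
  "extend_zero U \<kappa> F p = (if p \<in> U then F (\<kappa> p) else 0)"

locale smooth_atlas =
  fixes \<A> :: "('m::{t2_space,second_countable_topology}, 'n::finite) chart set"
  assumes atlas: "smooth_manifold \<A>"
begin

lemma chart_at: obtains U \<kappa> where "(U, \<kappa>) \<in> \<A>" "x \<in> U"
proof -
  have "x \<in> (\<Union>(U, \<kappa>)\<in>\<A>. U)" using atlas by (simp add: smooth_manifold_def)
  then show ?thesis using that by auto
qed

lemma
  assumes "(U, \<kappa>) \<in> \<A>"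
  shows open_chart: "open U" and open_chart_image: "open (\<kappa> ` U)"
    and chart_homeomorphism: "homeomorphism U (\<kappa> ` U) \<kappa> (inv_into U \<kappa>)"
  using assms atlas unfolding smooth_manifold_def by auto

lemma smooth_transition:
  assumes "(U, \<kappa>) \<in> \<A>" "(V, \<mu>) \<in> \<A>"
  shows "smooth_on (\<kappa> ` (U \<inter> V)) (\<mu> \<circ> inv_into U \<kappa>)"
  using assms atlas unfolding smooth_manifold_def by blast

lemma chart_inv: "(U, \<kappa>) \<in> \<A> \<Longrightarrow> p \<in> U \<Longrightarrow> inv_into U \<kappa> (\<kappa> p) = p"
  by (meson chart_homeomorphism homeomorphism_apply1)

lemma chart_inj: "(U, \<kappa>) \<in> \<A> \<Longrightarrow> p \<in> U \<Longrightarrow> q \<in> U \<Longrightarrow> \<kappa> p = \<kappa> q \<Longrightarrow> p = q"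
  by (metis chart_inv)

lemma open_chart_image_subset:
  assumes c: "(U, \<kappa>) \<in> \<A>" and W: "open W" "W \<subseteq> U"
  shows "open (\<kappa> ` W)"
proof -
  have "openin (top_of_set U) W" using W open_chart[OF c] by (simp add: openin_open_eq)
  then have "openin (top_of_set (\<kappa> ` U)) (\<kappa> ` W)"
    by (rule homeomorphism_imp_open_map[OF chart_homeomorphism[OF c]])
  then show ?thesis using open_chart_image[OF c] by (simp add: openin_open_eq)
qed

lemma smooth_funD:
  "smooth_fun \<A> f \<Longrightarrow> (U, \<kappa>) \<in> \<A> \<Longrightarrow> smooth_on (\<kappa> ` U) (\<lambda>y. f (inv_into U \<kappa> y))"
  by (auto simp: smooth_fun_def o_def)

lemma smooth_funI:
  "(\<And>U \<kappa>. (U, \<kappa>) \<in> \<A> \<Longrightarrow> smooth_on (\<kappa> ` U) (\<lambda>y. f (inv_into U \<kappa> y))) \<Longrightarrow> smooth_fun \<A> f"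
  by (auto simp: smooth_fun_def o_def)

lemma smooth_fun_const: "smooth_fun \<A> (\<lambda>x. c)"
  by (intro smooth_funI smooth_on_const)

lemma smooth_fun_add: "smooth_fun \<A> f \<Longrightarrow> smooth_fun \<A> h \<Longrightarrow> smooth_fun \<A> (f + h)"
proof (rule smooth_funI)
  fix U \<kappa> assume f: "smooth_fun \<A> f" and h: "smooth_fun \<A> h" and c: "(U, \<kappa>) \<in> \<A>"
  show "smooth_on (\<kappa> ` U) (\<lambda>y. (f + h) (inv_into U \<kappa> y))"
    using smooth_on_add[OF open_chart_image[OF c] smooth_funD[OF f c] smooth_funD[OF h c]] by simp
qed

lemma smooth_fun_mult: "smooth_fun \<A> f \<Longrightarrow> smooth_fun \<A> h \<Longrightarrow> smooth_fun \<A> (f * h)"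
proof (rule smooth_funI)
  fix U \<kappa> assume f: "smooth_fun \<A> f" and h: "smooth_fun \<A> h" and c: "(U, \<kappa>) \<in> \<A>"
  show "smooth_on (\<kappa> ` U) (\<lambda>y. (f * h) (inv_into U \<kappa> y))"
    using smooth_on_mult[OF open_chart_image[OF c] smooth_funD[OF f c] smooth_funD[OF h c]] by simp
qed

lemma smooth_fun_cmult: "smooth_fun \<A> f \<Longrightarrow> smooth_fun \<A> (\<lambda>x. c * f x)"
  using smooth_fun_mult[OF smooth_fun_const] unfolding times_fun_def .

lemma smooth_fun_diff:
  assumes "smooth_fun \<A> f" "smooth_fun \<A> h"
  shows "smooth_fun \<A> (f - h)"
proof -
  have "f - h = f + (\<lambda>x. (-1) * h x)" by (simp add: fun_eq_iff)
  then show ?thesis using smooth_fun_add[OF assms(1) smooth_fun_cmult[OF assms(2)]] by (simp only:)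
qed

lemma smooth_fun_uminus: "smooth_fun \<A> f \<Longrightarrow> smooth_fun \<A> (- f)"
  using smooth_fun_cmult[of f "-1"] by (simp add: fun_Compl_def)

lemma smooth_fun_sum:
  "finite I \<Longrightarrow> (\<And>i. i \<in> I \<Longrightarrow> smooth_fun \<A> (f i)) \<Longrightarrow> smooth_fun \<A> (\<Sum>i\<in>I. f i)"
proof (induction rule: finite_induct)
  case empty
  then show ?case using smooth_fun_const[of 0] by (simp add: zero_fun_def)
qed (simp add: smooth_fun_add)

lemma smooth_fun_continuous: "smooth_fun \<A> f \<Longrightarrow> continuous_on UNIV f"
proof -
  assume f: "smooth_fun \<A> f"
  have "continuous (at x) f" for x
  proof -
    obtain U \<kappa> where c: "(U, \<kappa>) \<in> \<A>" "x \<in> U" by (rule chart_at)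
    have "continuous_on U (\<lambda>p. f (inv_into U \<kappa> (\<kappa> p)))"
      by (rule continuous_on_compose2[OF smooth_on_continuous[OF smooth_funD[OF f c(1)]]])
        (use chart_homeomorphism[OF c(1)] in \<open>auto simp: homeomorphism_def\<close>)
    then have "continuous_on U f"
      by (rule continuous_on_eq) (simp add: chart_inv[OF c(1)])
    then show ?thesis using c open_chart continuous_on_eq_continuous_at by blast
  qed
  then show ?thesis by (simp add: continuous_at_imp_continuous_on)
qed

text \<open>The manifold is covered by two open sets: the chart domain, where a transition map gives
  smoothness, and the complement of the pullback of \<open>C\<close>, where the function is 0. The
  pullback is compact, and closed because the manifold is Hausdorff.\<close>

lemma smooth_fun_extend_zero:
  assumes c: "(U, \<kappa>) \<in> \<A>" and C: "compact C" "C \<subseteq> \<kappa> ` U"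
    and F: "smooth_on (\<kappa> ` U) F" "\<And>y. y \<in> \<kappa> ` U \<Longrightarrow> y \<notin> C \<Longrightarrow> F y = 0"
  shows "smooth_fun \<A> (extend_zero U \<kappa> F)"
proof (rule smooth_funI)
  fix V \<mu> assume d: "(V, \<mu>) \<in> \<A>"
  let ?K = "inv_into U \<kappa> ` C"
  have "continuous_on (\<kappa> ` U) (inv_into U \<kappa>)"
    using chart_homeomorphism[OF c] by (simp add: homeomorphism_def)
  then have "compact ?K" using C by (meson compact_continuous_image continuous_on_subset)
  then have K: "closed ?K" by (rule compact_imp_closed)
  show "smooth_on (\<mu> ` V) (\<lambda>y. extend_zero U \<kappa> F (inv_into V \<mu> y))"
  proof (rule smooth_on_local)
    fix y assume "y \<in> \<mu> ` V"
    then obtain p where p: "p \<in> V" "y = \<mu> p" by auto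
    show "\<exists>T. open T \<and> y \<in> T \<and> smooth_on T (\<lambda>y. extend_zero U \<kappa> F (inv_into V \<mu> y))"
    proof (cases "p \<in> U")
      case True
      let ?T = "\<mu> ` (V \<inter> U)"
      have T: "open ?T" using open_chart[OF c] open_chart[OF d]
        by (intro open_chart_image_subset[OF d]) auto
      have "smooth_on ?T (\<lambda>y. F ((\<kappa> \<circ> inv_into V \<mu>) y))"
        by (rule smooth_on_compose[OF T open_chart_image[OF c] _ smooth_transition[OF d c] F(1)])
          (auto simp: chart_inv[OF d])
      then have "smooth_on ?T (\<lambda>y. extend_zero U \<kappa> F (inv_into V \<mu> y))"
        by (subst smooth_on_cong[OF T, of _ "\<lambda>y. F ((\<kappa> \<circ> inv_into V \<mu>) y)"])
          (auto simp: chart_inv[OF d] extend_zero_def)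
      then show ?thesis using T True p by blast
    next
      case False
      let ?T = "\<mu> ` (V - ?K)"
      have T: "open ?T" using open_chart[OF d] K
        by (intro open_chart_image_subset[OF d]) auto
      have "extend_zero U \<kappa> F q = 0" if "q \<notin> ?K" for q
      proof (cases "q \<in> U")
        case True
        then have "\<kappa> q \<notin> C" using that by (metis chart_inv[OF c] image_eqI)
        then show ?thesis using F(2) True by (simp add: extend_zero_def)
      qed (simp add: extend_zero_def)
      then have "smooth_on ?T (\<lambda>y. extend_zero U \<kappa> F (inv_into V \<mu> y))"
        by (subst smooth_on_cong[OF T, of _ "\<lambda>y. 0"])
          (auto simp: chart_inv[OF d] smooth_on_const)
      moreover have "p \<notin> ?K"
      proof
        assume "p \<in> ?K"
        then obtain y where "y \<in> C" "p = inv_into U \<kappa> y" by auto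
        then show False using False C inv_into_into[of y \<kappa> U] by auto
      qed
      ultimately show ?thesis using T p by blast
    qed
  qed
qed

text \<open>\<open>G\<close> is smooth on \<open>S\<close> only, but the closed ball lies in
  \<open>S\<close> and the bump vanishes outside it, so the product is smooth on the whole chart
  image whatever \<open>G\<close> does there.\<close>

lemma smooth_fun_extend_bump:
  assumes c: "(U, \<kappa>) \<in> \<A>" and r: "r > 0" "cball a r \<subseteq> S" "open S" "S \<subseteq> \<kappa> ` U" and G: "smooth_on S G"
  shows "smooth_fun \<A> (extend_zero U \<kappa> (\<lambda>y. bump a r y * G y))"
proof (rule smooth_fun_extend_zero[OF c compact_cball])
  have z: "bump a r y = 0" if "y \<notin> cball a r" for y
    using that bump_nonzero_iff[OF r(1), of a y] ball_subset_cball by blast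
  then show "bump a r y * G y = 0" if "y \<notin> cball a r" for y using that by simp
  show "cball a r \<subseteq> \<kappa> ` U" using r by blast
  show "smooth_on (\<kappa> ` U) (\<lambda>y. bump a r y * G y)"
  proof (rule smooth_on_local)
    fix y assume "y \<in> \<kappa> ` U"
    show "\<exists>T. open T \<and> y \<in> T \<and> smooth_on T (\<lambda>y. bump a r y * G y)"
    proof (cases "y \<in> S")
      case True
      then show ?thesis using r G smooth_on_mult[OF \<open>open S\<close> smooth_on_bump G] by blast
    next
      case False
      have "smooth_on (- cball a r) (\<lambda>y. bump a r y * G y)"
        by (subst smooth_on_cong[of _ _ "\<lambda>y. 0"]) (auto simp: smooth_on_const z)
      then show ?thesis using False r
        by (intro exI[of _ "- cball a r"]) (auto simp: open_Compl)
    qed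
  qed
qed

lemma ex_bump:
  assumes "open N" "x \<in> N"
  obtains f where "smooth_fun \<A> f" "f x = 1" "\<And>y. y \<notin> N \<Longrightarrow> f y = 0"
proof -
  obtain U \<kappa> where c: "(U, \<kappa>) \<in> \<A>" "x \<in> U" by (rule chart_at)
  have o: "open (\<kappa> ` (U \<inter> N))"
    using open_chart[OF c(1)] assms by (intro open_chart_image_subset[OF c(1)]) auto
  then obtain r where r: "r > 0" "cball (\<kappa> x) r \<subseteq> \<kappa> ` (U \<inter> N)"
    using assms c open_contains_cball by blast
  let ?f = "extend_zero U \<kappa> (\<lambda>y. bump (\<kappa> x) r y * (1 / bump (\<kappa> x) r (\<kappa> x)))"
  show ?thesis
  proof (rule that[of ?f])
    show "smooth_fun \<A> ?f"
      by (rule smooth_fun_extend_bump[OF c(1) r(1,2) o _ smooth_on_const]) auto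
    show "?f x = 1" using c bump_nonzero_iff[OF r(1), of "\<kappa> x" "\<kappa> x"] r by (simp add: extend_zero_def)
    show "?f y = 0" if "y \<notin> N" for y
    proof (cases "y \<in> U")
      case True
      then have "\<kappa> y \<notin> \<kappa> ` (U \<inter> N)" using that chart_inj[OF c(1)] by fastforce
      then have "bump (\<kappa> x) r (\<kappa> y) = 0"
        using r bump_nonzero_iff[OF r(1), of "\<kappa> x" "\<kappa> y"] ball_subset_cball by blast
      then show ?thesis by (simp add: extend_zero_def)
    qed (simp add: extend_zero_def)
  qed
qed


section \<open>Vector fields\<close>

abbreviation "VF \<equiv> vector_field \<A>"
abbreviation "SF \<equiv> smooth_fun \<A>"

lemma
  assumes "VF X"
  shows vf_smooth: "SF f \<Longrightarrow> SF (X f)"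
    and vf_apply_add: "SF f \<Longrightarrow> SF h \<Longrightarrow> X (f + h) = X f + X h"
    and vf_apply_cmult: "SF f \<Longrightarrow> X (\<lambda>x. c * f x) = (\<lambda>x. c * X f x)"
    and vf_apply_mult: "SF f \<Longrightarrow> SF h \<Longrightarrow> X (f * h) = X f * h + f * X h"
    and vf_not_smooth: "\<not> SF f \<Longrightarrow> X f = 0"
  using assms unfolding vector_field_def by auto

text \<open>The default value 0 at non-smooth arguments covers the remaining case, so iterated
  derivatives carry no side condition on the innermost function.\<close>

lemma vf_smooth': "VF X \<Longrightarrow> SF (X f)"
  by (cases "SF f") (use smooth_fun_const[of 0] in \<open>auto simp: vf_smooth vf_not_smooth zero_fun_def\<close>)

lemma vf_apply_diff:
  assumes "VF X" "SF f" "SF h" shows "X (f - h) = X f - X h"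
proof -
  have "X ((f - h) + h) = X (f - h) + X h"
    using assms by (intro vf_apply_add smooth_fun_diff)
  then show ?thesis by simp
qed

lemma vf_apply_const: "VF X \<Longrightarrow> X (\<lambda>x. c) = 0"
proof -
  assume X: "VF X"
  have "X (1 * 1) = X 1 * 1 + 1 * X 1"
    using vf_apply_mult[OF X smooth_fun_const smooth_fun_const, of 1 1] by (simp add: one_fun_def)
  then have "X 1 = 0" by simp
  then show ?thesis
    using vf_apply_cmult[OF X smooth_fun_const, of c 1] by (simp add: one_fun_def zero_fun_def)
qed

lemma vf_apply_sum:
  assumes "VF X" "finite I" "\<And>i. i \<in> I \<Longrightarrow> SF (f i)"
  shows "X (\<Sum>i\<in>I. f i) = (\<Sum>i\<in>I. X (f i))"
  using assms(2,3)
proof (induction rule: finite_induct)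
  case empty
  then show ?case using vf_apply_const[OF assms(1), of 0] by (simp add: zero_fun_def)
next
  case (insert i I)
  then show ?case
    using vf_apply_add[OF assms(1) _ smooth_fun_sum[of I f], of "f i"] by (simp del: plus_fun_apply)
qed

lemma sum_fun_apply: "(\<Sum>i\<in>I. f i) x = (\<Sum>i\<in>I. f i x)" for f :: "'c \<Rightarrow> 'b \<Rightarrow> 'd::comm_monoid_add"
  by (induction I rule: infinite_finite_induct) auto

lemma vf_add:
  assumes X: "VF X" and Y: "VF Y" shows "VF (X + Y)"
  unfolding vector_field_def
proof (intro conjI allI impI)
  fix f h c
  show "SF ((X + Y) f)" if "SF f"
    unfolding plus_fun_apply[of X Y] by (intro smooth_fun_add vf_smooth[OF X that] vf_smooth[OF Y that])
  show "(X + Y) (f + h) = (X + Y) f + (X + Y) h" if "SF f" "SF h"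
    unfolding plus_fun_apply[of X Y] vf_apply_add[OF X that] vf_apply_add[OF Y that] by simp
  show "(X + Y) (\<lambda>x. c * f x) = (\<lambda>x. c * (X + Y) f x)" if "SF f"
    unfolding plus_fun_apply[of X Y] vf_apply_cmult[OF X that] vf_apply_cmult[OF Y that]
    by (simp add: fun_eq_iff algebra_simps)
  show "(X + Y) (f * h) = (X + Y) f * h + f * (X + Y) h" if "SF f" "SF h"
    unfolding plus_fun_apply[of X Y] vf_apply_mult[OF X that] vf_apply_mult[OF Y that]
    by (simp add: algebra_simps)
  show "(X + Y) f = 0" if "\<not> SF f"
    unfolding plus_fun_apply[of X Y] vf_not_smooth[OF X that] vf_not_smooth[OF Y that] by (rule add_0)
qed

lemma vf_scale:
  assumes X: "VF X" and k: "SF k" shows "VF (k \<cdot> X)"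
  unfolding vector_field_def fun_scale_def
proof (intro conjI allI impI)
  fix f h c
  show "SF (k * X f)" if "SF f"
    by (intro smooth_fun_mult k vf_smooth[OF X that])
  show "k * X (f + h) = k * X f + k * X h" if "SF f" "SF h"
    unfolding vf_apply_add[OF X that] by (simp add: algebra_simps)
  show "k * X (\<lambda>x. c * f x) = (\<lambda>x. c * (k * X f) x)" if "SF f"
    unfolding vf_apply_cmult[OF X that] by (simp add: fun_eq_iff)
  show "k * X (f * h) = k * X f * h + f * (k * X h)" if "SF f" "SF h"
    unfolding vf_apply_mult[OF X that] by (simp add: algebra_simps)
  show "k * X f = 0" if "\<not> SF f" unfolding vf_not_smooth[OF X that] by (rule mult_zero_right)
qed

lemma vf_zero: "VF 0"
  unfolding vector_field_def using smooth_fun_const[of 0] by (auto simp: zero_fun_def fun_eq_iff)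

lemma vf_uminus: assumes "VF X" shows "VF (- X)"
proof -
  have "(\<lambda>x. -1) \<cdot> X = - X" by (simp add: fun_eq_iff fun_scale_def)
  then show ?thesis using vf_scale[OF assms smooth_fun_const, of "-1"] by simp
qed

lemma vf_diff: "VF X \<Longrightarrow> VF Y \<Longrightarrow> VF (X - Y)"
  unfolding diff_conv_add_uminus[of X Y] by (intro vf_add vf_uminus)

lemma vf_sum: "finite I \<Longrightarrow> (\<And>i. i \<in> I \<Longrightarrow> VF (X i)) \<Longrightarrow> VF (\<Sum>i\<in>I. X i)"
  by (induction rule: finite_induct) (simp_all add: vf_zero vf_add del: plus_fun_apply)

lemma vf_lie:
  assumes X: "VF X" and Y: "VF Y" shows "VF (lie X Y)"
  unfolding vector_field_def lie_def
proof (intro conjI allI impI)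
  fix f h c
  show "SF (X (Y f) - Y (X f))" if "SF f"
    by (intro smooth_fun_diff vf_smooth[OF X vf_smooth[OF Y that]] vf_smooth[OF Y vf_smooth[OF X that]])
  show "X (Y (f + h)) - Y (X (f + h)) = X (Y f) - Y (X f) + (X (Y h) - Y (X h))" if "SF f" "SF h"
    unfolding vf_apply_add[OF X that] vf_apply_add[OF Y that]
      vf_apply_add[OF X vf_smooth[OF Y that(1)] vf_smooth[OF Y that(2)]]
      vf_apply_add[OF Y vf_smooth[OF X that(1)] vf_smooth[OF X that(2)]]
    by (simp add: algebra_simps)
  show "X (Y (\<lambda>x. c * f x)) - Y (X (\<lambda>x. c * f x)) = (\<lambda>x. c * (X (Y f) - Y (X f)) x)" if "SF f"
    unfolding vf_apply_cmult[OF X that] vf_apply_cmult[OF Y that]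
      vf_apply_cmult[OF X vf_smooth[OF Y that]] vf_apply_cmult[OF Y vf_smooth[OF X that]]
    by (simp add: fun_eq_iff algebra_simps)
  show "X (Y (f * h)) - Y (X (f * h)) = (X (Y f) - Y (X f)) * h + f * (X (Y h) - Y (X h))"
    if "SF f" "SF h"
  proof -
    note s = vf_smooth[OF X that(1)] vf_smooth[OF X that(2)] vf_smooth[OF Y that(1)] vf_smooth[OF Y that(2)]
    show ?thesis
      unfolding vf_apply_mult[OF X that] vf_apply_mult[OF Y that]
        vf_apply_add[OF X smooth_fun_mult[OF s(3) that(2)] smooth_fun_mult[OF that(1) s(4)]]
        vf_apply_add[OF Y smooth_fun_mult[OF s(1) that(2)] smooth_fun_mult[OF that(1) s(2)]]
        vf_apply_mult[OF X s(3) that(2)] vf_apply_mult[OF X that(1) s(4)]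
        vf_apply_mult[OF Y s(1) that(2)] vf_apply_mult[OF Y that(1) s(2)]
      by (simp add: algebra_simps)
  qed
  show "X (Y f) - Y (X f) = 0" if "\<not> SF f"
    using vf_apply_const[OF X, of 0] vf_apply_const[OF Y, of 0]
    unfolding vf_not_smooth[OF X that] vf_not_smooth[OF Y that] zero_fun_def[symmetric] by (simp only: diff_self)
qed


section \<open>Local frames\<close>

definition coord_deriv :: "'m set \<Rightarrow> ('m \<Rightarrow> real^'n) \<Rightarrow> 'n \<Rightarrow> ('m \<Rightarrow> real) \<Rightarrow> real^'n \<Rightarrow> real" where
  "coord_deriv U \<kappa> i f y = frechet_derivative (\<lambda>y. f (inv_into U \<kappa> y)) (at y) (axis i 1)"

text \<open>A coordinate derivation lives on the chart alone; the cut-off \<open>\<beta>\<close>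
  makes it global. The conditional provides the value 0 at non-smooth arguments that
  \<open>vector_field\<close> demands.\<close>

definition coord_field ::
  "'m set \<Rightarrow> ('m \<Rightarrow> real^'n) \<Rightarrow> (real^'n \<Rightarrow> real) \<Rightarrow> 'n \<Rightarrow> 'm vfield" where
  "coord_field U \<kappa> \<beta> i f =
     (if smooth_fun \<A> f then extend_zero U \<kappa> (\<lambda>y. \<beta> y * coord_deriv U \<kappa> i f y) else 0)"

lemma chart_has_derivative:
  assumes "(U, \<kappa>) \<in> \<A>" "SF f" "y \<in> \<kappa> ` U"
  shows "((\<lambda>y. f (inv_into U \<kappa> y)) has_derivative
    frechet_derivative (\<lambda>y. f (inv_into U \<kappa> y)) (at y)) (at y)"
  using smooth_on_differentiable[OF smooth_funD[OF assms(2,1)] assms(3)]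
  by (simp add: frechet_derivative_works[symmetric])

lemma vf_coord_field:
  assumes c: "(U, \<kappa>) \<in> \<A>" and r: "r > 0" "cball a r \<subseteq> \<kappa> ` U"
  shows "VF (coord_field U \<kappa> (bump a r) i)"
  unfolding vector_field_def
proof (intro conjI allI impI)
  fix f h k
  let ?E = "coord_field U \<kappa> (bump a r) i"
  note d = chart_has_derivative[OF c]
  show "SF (?E f)" if "SF f"
    using that smooth_on_derivative[OF smooth_funD[OF that c], of "axis i 1"]
    by (auto simp: coord_field_def coord_deriv_def
        intro: smooth_fun_extend_bump[OF c r open_chart_image[OF c] order_refl])
  show "?E (f + h) = ?E f + ?E h" if "SF f" "SF h"
  proof
    fix p
    have "coord_deriv U \<kappa> i (f + h) (\<kappa> p) = coord_deriv U \<kappa> i f (\<kappa> p) + coord_deriv U \<kappa> i h (\<kappa> p)"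
      if "p \<in> U"
      using fun_cong[OF frechet_derivative_at[OF has_derivative_add[OF d[OF \<open>SF f\<close>] d[OF \<open>SF h\<close>], of "\<kappa> p"]], of "axis i 1"] that
      by (simp add: coord_deriv_def)
    then show "?E (f + h) p = (?E f + ?E h) p"
      using that by (simp add: coord_field_def smooth_fun_add extend_zero_def algebra_simps)
  qed
  show "?E (\<lambda>x. k * f x) = (\<lambda>x. k * ?E f x)" if "SF f"
  proof
    fix p
    have "coord_deriv U \<kappa> i (\<lambda>x. k * f x) (\<kappa> p) = k * coord_deriv U \<kappa> i f (\<kappa> p)"
      if "p \<in> U"
      using fun_cong[OF frechet_derivative_at[OF has_derivative_mult_right[OF d[OF \<open>SF f\<close>], of "\<kappa> p" k]], of "axis i 1"] that
      by (simp add: coord_deriv_def)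
    then show "?E (\<lambda>x. k * f x) p = k * ?E f p"
      using that by (simp add: coord_field_def smooth_fun_cmult extend_zero_def)
  qed
  show "?E (f * h) = ?E f * h + f * ?E h" if "SF f" "SF h"
  proof
    fix p
    have "coord_deriv U \<kappa> i (f * h) (\<kappa> p) = coord_deriv U \<kappa> i f (\<kappa> p) * h p + f p * coord_deriv U \<kappa> i h (\<kappa> p)"
      if "p \<in> U"
      using fun_cong[OF frechet_derivative_at[OF has_derivative_mult[OF d[OF \<open>SF f\<close>] d[OF \<open>SF h\<close>], of "\<kappa> p"]], of "axis i 1"] that
      by (simp add: coord_deriv_def chart_inv[OF c that] add.commute)
    then show "?E (f * h) p = (?E f * h + f * ?E h) p"
      using that by (simp add: coord_field_def smooth_fun_mult extend_zero_def algebra_simps)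
  qed
  show "?E f = 0" if "\<not> SF f" using that by (simp add: coord_field_def)
qed

text \<open>The coefficient of the i-th coordinate derivative is \<open>X\<close> applied to the
  bump times (i-th coordinate minus its value at \<open>p\<close>). Hadamard's lemma expresses f -
  f(p) through these functions, and since they vanish at \<open>p\<close>, the product rule leaves
  only their derivatives.\<close>

lemma vf_expansion_chart:
  assumes X: "VF X" and f: "SF f" and c: "(U, \<kappa>) \<in> \<A>"
    and r: "r > 0" "cball a r \<subseteq> S" "open S" "convex S" "S \<subseteq> \<kappa> ` U"
    and p: "p \<in> U" "\<kappa> p \<in> ball a r"
  shows "bump a r (\<kappa> p) * X f p =
    (\<Sum>i\<in>UNIV. (X (extend_zero U \<kappa> (\<lambda>y. bump a r y * (y $ i - a $ i))) p
       - (\<kappa> p $ i - a $ i) * X (extend_zero U \<kappa> (bump a r)) p) * coord_deriv U \<kappa> i f (\<kappa> p))"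
proof -
  let ?F = "\<lambda>y. f (inv_into U \<kappa> y)" and ?q = "\<kappa> p" and ?b = "extend_zero U \<kappa> (bump a r)"
  let ?B = "\<lambda>i. extend_zero U \<kappa> (\<lambda>y. bump a r y * (y $ i - a $ i))"
  have F: "smooth_on S ?F" using smooth_on_subset[OF smooth_funD[OF f c] r(5)] .
  have q: "?q \<in> S" using p r ball_subset_cball by blast
  obtain G where G: "\<And>i. smooth_on S (G i)"
    "\<And>y. y \<in> S \<Longrightarrow> ?F y = ?F ?q + (\<Sum>i\<in>UNIV. (y $ i - ?q $ i) * G i y)"
    "\<And>i. G i ?q = frechet_derivative ?F (at ?q) (axis i 1)"
    by (rule Hadamard[OF r(3,4) q F]) (rule that)
  let ?g = "\<lambda>i. extend_zero U \<kappa> (\<lambda>y. bump a r y * G i y)"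
  let ?Y = "\<lambda>i. ?B i - (\<lambda>x. (?q $ i - a $ i) * ?b x)"
  note ext = smooth_fun_extend_bump[OF c r(1,2,3,5)]
  have b: "SF ?b" using ext[OF smooth_on_const[of S 1]] by simp
  have B: "SF (?B i)" for i
  proof (rule ext)
    have "smooth_on S (\<lambda>y. y $ i + - (a $ i))"
      by (intro smooth_on_add smooth_on_const smooth_on_linear bounded_linear_vec_nth r)
    then show "smooth_on S (\<lambda>y. y $ i - a $ i)" by simp
  qed
  have g: "SF (?g i)" for i by (rule ext[OF G(1)])
  have Y: "SF (?Y i)" for i by (intro smooth_fun_diff smooth_fun_cmult B b)
  \<comment> \<open>The bump enters squared, once for the coordinate factor and once for the
    Hadamard coefficient: both must become global functions before \<open>X\<close> can act on
    them.\<close>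
  have eq: "(?b * ?b) * (f - (\<lambda>x. f p)) = (\<Sum>i\<in>UNIV. ?Y i * ?g i)"
  proof
    fix z
    show "((?b * ?b) * (f - (\<lambda>x. f p))) z = (\<Sum>i\<in>UNIV. ?Y i * ?g i) z"
    proof (cases "z \<in> U \<and> \<kappa> z \<in> ball a r")
      case True
      then have "\<kappa> z \<in> S" using r ball_subset_cball by blast
      then have "f z - f p = (\<Sum>i\<in>UNIV. (\<kappa> z $ i - ?q $ i) * G i (\<kappa> z))"
        using G(2)[of "\<kappa> z"] True p by (simp add: chart_inv[OF c])
      then show ?thesis using True p
        by (simp add: sum_fun_apply extend_zero_def sum_distrib_left algebra_simps)
    next
      case False
      then have "?b z = 0" "?g i z = 0" for i
        using bump_nonzero_iff[OF r(1), of a "\<kappa> z"] by (auto simp: extend_zero_def)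
      then show ?thesis by (simp add: sum_fun_apply)
    qed
  qed
  have f': "SF (f - (\<lambda>x. f p))" by (intro smooth_fun_diff f smooth_fun_const)
  have Xf': "X (f - (\<lambda>x. f p)) = X f"
    unfolding vf_apply_diff[OF X f smooth_fun_const] vf_apply_const[OF X] by simp
  have "X ((?b * ?b) * (f - (\<lambda>x. f p))) p = ?b p * ?b p * X f p"
    unfolding vf_apply_mult[OF X smooth_fun_mult[OF b b] f'] Xf' by simp
  moreover have "X (\<Sum>i\<in>UNIV. ?Y i * ?g i) p = (\<Sum>i\<in>UNIV. X (?Y i) p * ?g i p)"
  proof -
    have "?Y i p = 0" for i using p by (simp add: extend_zero_def algebra_simps)
    then have "X (?Y i * ?g i) p = X (?Y i) p * ?g i p" for i
      unfolding vf_apply_mult[OF X Y g] by simp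
    then show ?thesis
      using vf_apply_sum[OF X finite, of UNIV "\<lambda>i. ?Y i * ?g i"] smooth_fun_mult[OF Y g]
      by (simp add: sum_fun_apply)
  qed
  moreover have "X (?Y i) p = X (?B i) p - (?q $ i - a $ i) * X ?b p" for i
    unfolding vf_apply_diff[OF X B smooth_fun_cmult[OF b]] vf_apply_cmult[OF X b] by simp
  moreover have "?g i p = bump a r ?q * coord_deriv U \<kappa> i f ?q" for i
    using p by (simp add: extend_zero_def G(3) coord_deriv_def)
  moreover have "?b p = bump a r ?q" using p by (simp add: extend_zero_def)
  ultimately have "bump a r ?q * (bump a r ?q * X f p) = bump a r ?q * (\<Sum>i\<in>UNIV.
      (X (?B i) p - (?q $ i - a $ i) * X ?b p) * coord_deriv U \<kappa> i f ?q)"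
    using eq by (simp add: sum_distrib_left mult_ac)
  then show ?thesis using bump_nonzero_iff[OF r(1), of a ?q] p by simp
qed

text \<open>The coordinate fields are cut off by a bump function \<open>b\<close>; the coefficients of the expansion
  are then global smooth functions, at the price of the factor \<open>b\<^sup>3\<close>.\<close>

lemma local_frame:
  obtains b B E where "SF b" "b x \<noteq> 0" "\<And>i::'n. SF (B i)" "\<And>i. VF (E i)"
    "\<And>X f p. VF X \<Longrightarrow> SF f \<Longrightarrow>
       b p ^ 3 * X f p = (\<Sum>i\<in>UNIV. (b p * X (B i) p - B i p * X b p) * E i f p)"
    "\<And>i j. E i (B j) x = (if i = j then (b x)\<^sup>2 else 0)"
proof -
  obtain U \<kappa> where c: "(U, \<kappa>) \<in> \<A>" "x \<in> U" by (rule chart_at)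
  define a where "a = \<kappa> x"
  obtain R where R: "R > 0" "ball a R \<subseteq> \<kappa> ` U"
    using open_chart_image[OF c(1)] c a_def open_contains_ball by blast
  define r where "r = R / 2"
  have r: "r > 0" "cball a r \<subseteq> ball a R" using R by (auto simp: r_def)
  define b where "b = extend_zero U \<kappa> (bump a r)"
  define B where "B i = extend_zero U \<kappa> (\<lambda>y. bump a r y * (y $ i - a $ i))" for i
  define E where "E = coord_field U \<kappa> (bump a r)"
  note ext = smooth_fun_extend_bump[OF c(1) r open_ball R(2)]
  have b: "SF b" using ext[OF smooth_on_const[of _ 1]] by (simp add: b_def)
  have lin: "smooth_on (ball a R) (\<lambda>y. y $ i - a $ i)" for i
  proof -
    have "smooth_on (ball a R) (\<lambda>y. y $ i + - (a $ i))"
      by (intro smooth_on_add smooth_on_const smooth_on_linear bounded_linear_vec_nth open_ball)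
    then show ?thesis by simp
  qed
  have B: "SF (B i)" for i unfolding B_def by (rule ext[OF lin])
  have ba: "bump a r a \<noteq> 0" using bump_nonzero_iff[OF r(1), of a a] r by simp
  show ?thesis
  proof
    show "SF b" "SF (B i)" for i by (rule b B)+
    show "b x \<noteq> 0" using ba c by (simp add: b_def extend_zero_def a_def)
    show "VF (E i)" for i unfolding E_def using r R by (intro vf_coord_field c) auto
    \<comment> \<open>On the support of \<open>b\<close> the i-th coordinate minus its centre value
      is B_i / b, so by the quotient rule the coefficient is the square of \<open>b\<close> times
      the derivative of that coordinate. The third factor \<open>b\<close> sits in
      \<open>E i\<close>; off the support both sides are 0.\<close>
    show "b p ^ 3 * X f p = (\<Sum>i\<in>UNIV. (b p * X (B i) p - B i p * X b p) * E i f p)"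
      if X: "VF X" and f: "SF f" for X f p
    proof (cases "p \<in> U \<and> \<kappa> p \<in> ball a r")
      case True
      have "bump a r (\<kappa> p) * X f p =
        (\<Sum>i\<in>UNIV. (X (B i) p - (\<kappa> p $ i - a $ i) * X b p) * coord_deriv U \<kappa> i f (\<kappa> p))"
        unfolding B_def b_def
        by (rule vf_expansion_chart[OF X f c(1) r open_ball convex_ball R(2)]) (use True in auto)
      then have "b p ^ 2 * (bump a r (\<kappa> p) * X f p) = b p ^ 2 *
        (\<Sum>i\<in>UNIV. (X (B i) p - (\<kappa> p $ i - a $ i) * X b p) * coord_deriv U \<kappa> i f (\<kappa> p))"
        by simp
      then show ?thesis using True f
        by (simp add: E_def coord_field_def b_def B_def extend_zero_def sum_distrib_left
            power2_eq_square power3_eq_cube algebra_simps)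
    next
      case False
      then have "b p = 0" "E i f p = 0" for i
        using bump_nonzero_iff[OF r(1), of a "\<kappa> p"] f
        by (auto simp: b_def E_def coord_field_def extend_zero_def)
      then show ?thesis by simp
    qed
    \<comment> \<open>The bump is centred at the image of \<open>x\<close>, where y_j - a_j
      vanishes, so the derivative of the bump itself drops out.\<close>
    show "E i (B j) x = (if i = j then (b x)\<^sup>2 else 0)" for i j
    proof -
      let ?D = "frechet_derivative (bump a r) (at a)"
      have "(bump a r has_derivative ?D) (at a)"
        using smooth_on_differentiable[OF smooth_on_bump[of UNIV]]
        by (simp add: frechet_derivative_works[symmetric])
      then have "((\<lambda>y. bump a r y * (y $ j - a $ j)) has_derivative
          (\<lambda>v. bump a r a * (v $ j - 0) + ?D v * (a $ j - a $ j))) (at a)"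
        by (intro has_derivative_mult has_derivative_diff has_derivative_const
            bounded_linear_imp_has_derivative bounded_linear_vec_nth)
      then have "((\<lambda>y. B j (inv_into U \<kappa> y)) has_derivative
          (\<lambda>v. bump a r a * (v $ j - 0) + ?D v * (a $ j - a $ j))) (at a)"
        by (rule has_derivative_transform_within_open[OF _ open_chart_image[OF c(1)]])
          (use c in \<open>auto simp: B_def extend_zero_def chart_inv a_def\<close>)
      from fun_cong[OF frechet_derivative_at[OF this], of "axis i 1"]
      have "coord_deriv U \<kappa> i (B j) a = bump a r a * (axis i 1 $ j)"
        by (simp add: coord_deriv_def)
      then show ?thesis
        using c B by (simp add: E_def coord_field_def extend_zero_def b_def a_def axis_def power2_eq_square)
    qed
  qed
qed

section \<open>Values at a point: tensoriality, frames, locality\<close>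

lemma one_form_sum:
  assumes w: "one_form \<A> \<omega>" "finite I" "\<And>i. i \<in> I \<Longrightarrow> VF (X i)"
  shows "\<omega> (\<Sum>i\<in>I. X i) = (\<Sum>i\<in>I. \<omega> (X i))"
  using assms(2,3)
proof (induction rule: finite_induct)
  case empty
  have "\<omega> (0 + 0) = \<omega> 0 + \<omega> 0" using w(1) vf_zero unfolding one_form_def by blast
  then have "\<omega> 0 = 0" by (simp del: zero_fun_apply)
  then show ?case by (simp only: sum.empty)
next
  case (insert i I)
  then show ?case using w(1) vf_sum[of I X] by (simp add: one_form_def del: plus_fun_apply)
qed

text \<open>Multiplied by \<open>b ^ 3\<close>, the field \<open>X\<close> is a global combination
  of the \<open>E i\<close> with smooth coefficients, through which \<open>\<omega>\<close> passes.
  The coefficients are built from derivatives of functions along \<open>X\<close>, hence vanish at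
  \<open>x\<close>, while \<open>b x\<close> does not.\<close>

lemma one_form_zero_at:
  assumes w: "one_form \<A> \<omega>" and X: "VF X" and X0: "val x X = 0"
  shows "\<omega> X x = 0"
proof -
  obtain b B E where fr: "SF b" "b x \<noteq> 0" "\<And>i::'n. SF (B i)" "\<And>i. VF (E i)"
    "\<And>X f p. VF X \<Longrightarrow> SF f \<Longrightarrow>
       b p ^ 3 * X f p = (\<Sum>i\<in>UNIV. (b p * X (B i) p - B i p * X b p) * E i f p)"
    "\<And>i j. E i (B j) x = (if i = j then (b x)\<^sup>2 else 0)"
    by (rule local_frame[of x]) (rule that)
  let ?c = "\<lambda>i. b * X (B i) - B i * X b"
  have c: "SF (?c i)" for i by (intro smooth_fun_diff smooth_fun_mult fr vf_smooth[OF X fr(3)] vf_smooth[OF X fr(1)])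
  have b3: "SF (b ^ 3)" unfolding power3_eq_cube by (intro smooth_fun_mult fr)
  have pow: "(b ^ 3) p = b p ^ 3" for p by (simp add: power3_eq_cube)
  have "b ^ 3 \<cdot> X = (\<Sum>i\<in>UNIV. ?c i \<cdot> E i)"
  proof (intro ext)
    fix h p
    show "(b ^ 3 \<cdot> X) h p = (\<Sum>i\<in>UNIV. ?c i \<cdot> E i) h p"
    proof (cases "SF h")
      case True
      then show ?thesis using fr(5)[OF X True, of p]
        by (simp add: fun_scale_def sum_fun_apply pow)
    next
      case False
      then show ?thesis
        by (simp add: fun_scale_def sum_fun_apply vf_not_smooth[OF X] vf_not_smooth[OF fr(4)])
    qed
  qed
  then have "\<omega> (b ^ 3 \<cdot> X) = (\<Sum>i\<in>UNIV. \<omega> (?c i \<cdot> E i))"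
    using one_form_sum[OF w finite[of UNIV], of "\<lambda>i. ?c i \<cdot> E i"] vf_scale[OF fr(4) c] by simp
  then have "b ^ 3 * \<omega> X = (\<Sum>i\<in>UNIV. ?c i * \<omega> (E i))"
    using w b3 X fr(4) c unfolding one_form_def by simp
  then have "b x ^ 3 * \<omega> X x = (\<Sum>i\<in>UNIV. ?c i x * \<omega> (E i) x)"
    by (metis (no_types, lifting) pow sum.cong sum_fun_apply times_fun_apply)
  also have "\<dots> = 0" using X0 by (simp add: val_def fun_eq_iff)
  finally show ?thesis using fr(2) by simp
qed

lemma ex_frame_at: "\<exists>E. frame_at \<A> x E"
proof -
  obtain b B E where fr: "SF b" "b x \<noteq> 0" "\<And>i::'n. SF (B i)" "\<And>i. VF (E i)"
    "\<And>X f p. VF X \<Longrightarrow> SF f \<Longrightarrow>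
       b p ^ 3 * X f p = (\<Sum>i\<in>UNIV. (b p * X (B i) p - B i p * X b p) * E i f p)"
    "\<And>i j. E i (B j) x = (if i = j then (b x)\<^sup>2 else 0)"
    by (rule local_frame[of x]) (rule that)
  have "\<exists>!c::real^'n. \<forall>h. val x X h = (\<Sum>i\<in>UNIV. c $ i * val x (E i) h)" if X: "VF X" for X
  proof
    let ?c = "\<chi> i. (b x * X (B i) x - B i x * X b x) / b x ^ 3"
    show "\<forall>h. val x X h = (\<Sum>i\<in>UNIV. ?c $ i * val x (E i) h)"
    proof
      fix h
      show "val x X h = (\<Sum>i\<in>UNIV. ?c $ i * val x (E i) h)"
      proof (cases "SF h")
        case True
        have "X h x = (\<Sum>i\<in>UNIV. (b x * X (B i) x - B i x * X b x) * E i h x) / b x ^ 3"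
          using fr(5)[OF X True, of x] fr(2) by (simp add: field_simps)
        then show ?thesis by (simp add: val_def sum_divide_distrib)
      next
        case False
        then show ?thesis
          by (simp add: val_def vf_not_smooth[OF X] vf_not_smooth[OF fr(4)])
      qed
    qed
    fix d :: "real^'n" assume d: "\<forall>h. val x X h = (\<Sum>i\<in>UNIV. d $ i * val x (E i) h)"
    \<comment> \<open>Evaluation at \<open>B j\<close> singles out the j-th coefficient, because the
      other \<open>E i\<close> annihilate \<open>B j\<close> at \<open>x\<close>.\<close>
    have "X (B j) x = d $ j * (b x)\<^sup>2" for j
      using d[rule_format, of "B j"]
      by (simp add: val_def fr(6) if_distrib[of "(*) _"] cong: if_cong)
    moreover have "X (B j) x = ?c $ j * (b x)\<^sup>2" for j
      using \<open>\<forall>h. val x X h = (\<Sum>i\<in>UNIV. ?c $ i * val x (E i) h)\<close>[rule_format, of "B j"]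
      by (simp add: val_def fr(6) if_distrib[of "(*) _"] cong: if_cong)
    ultimately have "d $ j * (b x)\<^sup>2 = ?c $ j * (b x)\<^sup>2" for j by (rule trans[OF sym])
    moreover have "(b x)\<^sup>2 \<noteq> 0" using fr(2) by simp
    ultimately have "d $ j = ?c $ j" for j by (rule mult_right_cancel[THEN iffD1, rotated])
    then show "d = ?c" by (simp only: vec_eq_iff simp_thms)
  qed
  then show ?thesis using fr(4) unfolding frame_at_def by auto
qed

lemma smooth_fun_numeral: "SF (numeral n)" "SF 1" "SF 0"
  using smooth_fun_const[of "numeral n"] smooth_fun_const[of 1] smooth_fun_const[of 0]
  by (simp_all add: numeral_fun one_fun_def zero_fun_def)

lemma vf_apply_numeral: "VF X \<Longrightarrow> X (numeral n) = 0" "VF X \<Longrightarrow> X 1 = 0" "VF X \<Longrightarrow> X 0 = 0"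
  using vf_apply_const[of X "numeral n"] vf_apply_const[of X 1] vf_apply_const[of X 0]
  by (simp_all only: numeral_fun one_fun_def zero_fun_def)

text \<open>Multiplying \<open>f\<close> by a bump supported in \<open>N\<close> gives the zero
  function. The product rule at \<open>x\<close>, where the bump is 1 and \<open>f\<close> is 0,
  returns \<open>X f x\<close>.\<close>

lemma vf_apply_zero_at:
  assumes X: "VF X" and f: "SF f" and N: "open N" "x \<in> N" "\<And>y. y \<in> N \<Longrightarrow> f y = 0"
  shows "X f x = 0"
proof -
  obtain b where b: "SF b" "b x = 1" "\<And>y. y \<notin> N \<Longrightarrow> b y = 0" by (rule ex_bump[OF N(1,2)]) (rule that)
  have "b * f = 0"
  proof
    fix y show "(b * f) y = 0 y" using N(3)[of y] b(3)[of y] by (cases "y \<in> N") auto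
  qed
  then have "X b * f + b * X f = 0"
    using vf_apply_mult[OF X b(1) f] vf_apply_numeral(3)[OF X] by (simp only:)
  then have "(X b * f + b * X f) x = 0" by (simp only: zero_fun_apply)
  then show ?thesis using b N by simp
qed

text \<open>The slots of \<phi>, \<eta>, \<open>g\<close>, \<open>D\<close> and \<open>R\<close> are
  additive on vector fields only; this transfers additivity to differences, negatives and 0 for all
  of them.\<close>

lemma additive_on_vf:
  fixes F :: "'m vfield \<Rightarrow> 'c::ab_group_add"
  assumes F: "\<And>X Y. VF X \<Longrightarrow> VF Y \<Longrightarrow> F (X + Y) = F X + F Y"
  shows "VF X \<Longrightarrow> VF Y \<Longrightarrow> F (X - Y) = F X - F Y" "VF X \<Longrightarrow> F (- X) = - F X" "F 0 = 0"
proof -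
  have z: "F 0 = 0" using F[OF vf_zero vf_zero] by (simp only: add_0 add_cancel_right_right)
  have m: "F (- X) = - F X" if "VF X" for X
  proof -
    have "F X + F (- X) = 0" using F[OF that vf_uminus[OF that]] z by (simp only: add.right_inverse)
    then show ?thesis by (rule minus_unique[symmetric])
  qed
  show "F 0 = 0" by (rule z)
  show "VF X \<Longrightarrow> F (- X) = - F X" by (rule m)
  assume "VF X" "VF Y"
  then show "F (X - Y) = F X - F Y"
    using F[of X "- Y"] m[of Y] vf_uminus[of Y] by (simp only: diff_conv_add_uminus)
qed

lemma lie_jacobi:
  assumes "VF X" "VF Y" "VF Z"
  shows "lie X (lie Y Z) + lie Y (lie Z X) + lie Z (lie X Y) = 0"
proof
  fix f
  note s = vf_smooth'
  have *: "lie X (lie Y Z) f = X (Y (Z f)) - X (Z (Y f)) - Y (Z (X f)) + Z (Y (X f))"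
    if "VF X" "VF Y" "VF Z" for X Y Z
    using vf_apply_diff[OF that(1) s[OF that(2)] s[OF that(3)], of "Z f" "Y f"]
    by (simp only: lie_def) (simp only: algebra_simps)
  show "(lie X (lie Y Z) + lie Y (lie Z X) + lie Z (lie X Y)) f = 0 f"
    unfolding plus_fun_apply[of _ _ f] *[OF assms] *[OF assms(2,3,1)] *[OF assms(3,1,2)]
    by (simp add: fun_eq_iff)
qed

end


section \<open>Para-Sasakian manifolds\<close>

locale para_sasakian_atlas = smooth_atlas \<A>
  for \<A> :: "('m::{t2_space,second_countable_topology}, 'n::finite) chart set" +
  fixes \<phi> :: "'m vfield \<Rightarrow> 'm vfield"
    and \<xi> :: "'m vfield"
    and \<eta> :: "'m vfield \<Rightarrow> 'm \<Rightarrow> real"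
    and g :: "'m vfield \<Rightarrow> 'm vfield \<Rightarrow> 'm \<Rightarrow> real"
    and nabla :: "'m connection"
  assumes para_sasakian: "para_sasakian \<A> \<phi> \<xi> \<eta> g nabla"
begin

definition D :: "'m connection" where
  "D = quarter_symmetric \<phi> \<xi> \<eta> g nabla"

lemma phi_vf: "VF X \<Longrightarrow> VF (\<phi> X)"
  and phi_add: "VF X \<Longrightarrow> VF Y \<Longrightarrow> \<phi> (X + Y) = \<phi> X + \<phi> Y"
  and phi_scale: "SF f \<Longrightarrow> VF X \<Longrightarrow> \<phi> (f \<cdot> X) = f \<cdot> \<phi> X"
  using para_sasakian unfolding para_sasakian_def endo_field_def by auto

lemmas phi_diff = additive_on_vf[of \<phi>, OF phi_add]

lemma xi_vf: "VF \<xi>"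
  using para_sasakian unfolding para_sasakian_def by auto

lemma eta_smooth: "VF X \<Longrightarrow> SF (\<eta> X)"
  and eta_add: "VF X \<Longrightarrow> VF Y \<Longrightarrow> \<eta> (X + Y) = \<eta> X + \<eta> Y"
  and eta_scale: "SF f \<Longrightarrow> VF X \<Longrightarrow> \<eta> (f \<cdot> X) = f * \<eta> X"
  using para_sasakian unfolding para_sasakian_def one_form_def by auto

lemmas eta_diff = additive_on_vf[of \<eta>, OF eta_add]

lemma g_one_form: "VF X \<Longrightarrow> one_form \<A> (g X)"
  and g_sym: "VF X \<Longrightarrow> VF Y \<Longrightarrow> g X Y = g Y X"
  and g_pos: "VF X \<Longrightarrow> val x X \<noteq> 0 \<Longrightarrow> g X X x > 0"
  using para_sasakian unfolding para_sasakian_def riemannian_metric_def by auto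

lemma g_smooth: "VF X \<Longrightarrow> VF Y \<Longrightarrow> SF (g X Y)"
  and g_add2: "VF X \<Longrightarrow> VF Y \<Longrightarrow> VF Z \<Longrightarrow> g X (Y + Z) = g X Y + g X Z"
  and g_scale2: "SF f \<Longrightarrow> VF X \<Longrightarrow> VF Y \<Longrightarrow> g X (f \<cdot> Y) = f * g X Y"
  using g_one_form unfolding one_form_def by auto

lemma g_add1: "VF X \<Longrightarrow> VF Y \<Longrightarrow> VF Z \<Longrightarrow> g (X + Y) Z = g X Z + g Y Z"
  using g_add2[of Z X Y] g_sym[of "X + Y" Z] g_sym[of X Z] g_sym[of Y Z] vf_add[of X Y]
  by (simp only:)

lemma g_scale1: "SF f \<Longrightarrow> VF X \<Longrightarrow> VF Y \<Longrightarrow> g (f \<cdot> X) Y = f * g X Y"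
  using g_scale2[of f Y X] g_sym[of "f \<cdot> X" Y] g_sym[of X Y] vf_scale[of X f]
  by (simp only:)

lemma g_diff2: "VF Z \<Longrightarrow> VF X \<Longrightarrow> VF Y \<Longrightarrow> g Z (X - Y) = g Z X - g Z Y"
  "VF Z \<Longrightarrow> VF X \<Longrightarrow> g Z (- X) = - g Z X" "VF Z \<Longrightarrow> g Z 0 = 0"
  using additive_on_vf[of "g Z"] g_add2 by blast+

lemma g_diff1: "VF Z \<Longrightarrow> VF X \<Longrightarrow> VF Y \<Longrightarrow> g (X - Y) Z = g X Z - g Y Z"
  "VF Z \<Longrightarrow> VF X \<Longrightarrow> g (- X) Z = - g X Z" "VF Z \<Longrightarrow> g 0 Z = 0"
  using additive_on_vf[of "\<lambda>X. g X Z"] g_add1 by blast+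

lemma eta_xi: "\<eta> \<xi> = 1" and phi_xi: "\<phi> \<xi> = 0"
  using para_sasakian unfolding para_sasakian_def by auto

lemma phi_phi: "VF X \<Longrightarrow> \<phi> (\<phi> X) = X - \<eta> X \<cdot> \<xi>"
  and eta_phi: "VF X \<Longrightarrow> \<eta> (\<phi> X) = 0"
  and g_xi2: "VF X \<Longrightarrow> g X \<xi> = \<eta> X"
  and nabla_xi: "VF X \<Longrightarrow> nabla X \<xi> = \<phi> X"
  using para_sasakian unfolding para_sasakian_def by auto

lemma g_xi1: "VF X \<Longrightarrow> g \<xi> X = \<eta> X"
  using g_sym[OF _ xi_vf] g_xi2 by metis

lemma g_phi_phi: "VF X \<Longrightarrow> VF Y \<Longrightarrow> g (\<phi> X) (\<phi> Y) = g X Y - \<eta> X * \<eta> Y"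
  and nabla_phi: "VF X \<Longrightarrow> VF Y \<Longrightarrow> nabla X (\<phi> Y) - \<phi> (nabla X Y)
     = - (g X Y \<cdot> \<xi>) - \<eta> Y \<cdot> X + (2 * \<eta> X * \<eta> Y) \<cdot> \<xi>"
  using para_sasakian unfolding para_sasakian_def by auto

text \<open>In the compatibility of \<open>g\<close> with \<phi>, replace \<open>Y\<close> by
  \<phi>Y: the left side becomes g(\<phi>X,Y) because \<phi>X is orthogonal to \<xi>, and the
  \<eta>-term on the right vanishes.\<close>

lemma g_phi: assumes "VF X" "VF Y" shows "g X (\<phi> Y) = g (\<phi> X) Y"
proof -
  have "g (\<phi> X) (\<phi> (\<phi> Y)) = g X (\<phi> Y)"
    using g_phi_phi[OF assms(1) phi_vf[OF assms(2)]]
    by (simp only: eta_phi[OF assms(2)] mult_zero_right diff_zero)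
  moreover have "g (\<phi> X) (\<phi> (\<phi> Y)) = g (\<phi> X) Y"
    by (simp only: phi_phi assms phi_vf g_diff2 vf_scale eta_smooth xi_vf g_scale2 g_xi2 eta_phi
        mult_zero_right diff_zero)
  ultimately show ?thesis by (simp only:)
qed

lemma g_phi_sym: "VF X \<Longrightarrow> VF Y \<Longrightarrow> g (\<phi> X) Y = g (\<phi> Y) X"
  using g_phi[of X Y] g_sym[of X "\<phi> Y"] phi_vf[of Y] by (simp only:)

lemma affine_nabla: "affine_connection \<A> nabla"
  and nabla_torsion: "VF X \<Longrightarrow> VF Y \<Longrightarrow> nabla X Y - nabla Y X = lie X Y"
  and nabla_metric: "VF X \<Longrightarrow> VF Y \<Longrightarrow> VF Z \<Longrightarrow> X (g Y Z) = g (nabla X Y) Z + g Y (nabla X Z)"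
  using para_sasakian unfolding para_sasakian_def levi_civita_def by auto

lemma nabla_vf: "VF X \<Longrightarrow> VF Y \<Longrightarrow> VF (nabla X Y)"
  and nabla_add1: "VF X \<Longrightarrow> VF Y \<Longrightarrow> VF Z \<Longrightarrow> nabla (X + Y) Z = nabla X Z + nabla Y Z"
  and nabla_scale1: "SF f \<Longrightarrow> VF X \<Longrightarrow> VF Y \<Longrightarrow> nabla (f \<cdot> X) Y = f \<cdot> nabla X Y"
  and nabla_add2: "VF X \<Longrightarrow> VF Y \<Longrightarrow> VF Z \<Longrightarrow> nabla X (Y + Z) = nabla X Y + nabla X Z"
  and nabla_scale2: "SF f \<Longrightarrow> VF X \<Longrightarrow> VF Y \<Longrightarrow> nabla X (f \<cdot> Y) = X f \<cdot> Y + f \<cdot> nabla X Y"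
  using affine_nabla unfolding affine_connection_def endo_field_def by auto

section \<open>The quarter-symmetric connection\<close>

lemma D_eq: "D X Y = nabla X Y + \<eta> Y \<cdot> \<phi> X - g (\<phi> X) Y \<cdot> \<xi>"
  by (simp add: D_def quarter_symmetric_def)

text \<open>Tensor identities are checked in two stages: expansion by linearity and the structure
  equations, with membership conditions met by these closure rules, and then evaluation at a
  function and a point, which leaves a polynomial identity between real numbers.\<close>

lemmas closed = vf_add vf_diff vf_uminus vf_zero vf_scale vf_lie phi_vf xi_vf
  g_smooth eta_smooth smooth_fun_add smooth_fun_diff smooth_fun_uminus smooth_fun_mult
  smooth_fun_numeral vf_smooth'

lemmas linear_simps = phi_add phi_diff phi_scale eta_add eta_diff eta_scale
  g_add1 g_add2 g_scale1 g_scale2 g_diff1 g_diff2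

lemmas structure_simps = eta_xi phi_xi phi_phi eta_phi g_xi1 g_xi2 g_phi g_phi_sym

lemmas fun_arith = fun_scale_def plus_fun_apply minus_apply uminus_apply times_fun_apply
  zero_fun_apply one_fun_apply numeral_fun_apply

lemma D_vf: "VF X \<Longrightarrow> VF Y \<Longrightarrow> VF (D X Y)"
  unfolding D_eq by (simp only: closed nabla_vf)

lemma D_add1: "VF X \<Longrightarrow> VF Y \<Longrightarrow> VF Z \<Longrightarrow> D (X + Y) Z = D X Z + D Y Z"
  unfolding D_eq by (simp only: closed nabla_vf nabla_add1 linear_simps)
    (simp add: fun_eq_iff fun_arith algebra_simps)

lemma D_scale1: "SF f \<Longrightarrow> VF X \<Longrightarrow> VF Y \<Longrightarrow> D (f \<cdot> X) Y = f \<cdot> D X Y"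
  unfolding D_eq by (simp only: closed nabla_vf nabla_scale1 linear_simps)
    (simp add: fun_eq_iff fun_arith algebra_simps)

lemma D_add2: "VF X \<Longrightarrow> VF Y \<Longrightarrow> VF Z \<Longrightarrow> D X (Y + Z) = D X Y + D X Z"
  unfolding D_eq by (simp only: closed nabla_vf nabla_add2 linear_simps)
    (simp add: fun_eq_iff fun_arith algebra_simps)

lemma D_scale2: "SF f \<Longrightarrow> VF X \<Longrightarrow> VF Y \<Longrightarrow> D X (f \<cdot> Y) = X f \<cdot> Y + f \<cdot> D X Y"
  unfolding D_eq by (simp only: closed nabla_vf nabla_scale2 linear_simps)
    (simp add: fun_eq_iff fun_arith algebra_simps)

lemma D_diff1: "VF Z \<Longrightarrow> VF X \<Longrightarrow> VF Y \<Longrightarrow> D (X - Y) Z = D X Z - D Y Z"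
  "VF Z \<Longrightarrow> VF X \<Longrightarrow> D (- X) Z = - D X Z" "VF Z \<Longrightarrow> D 0 Z = 0"
  using additive_on_vf[of "\<lambda>X. D X Z"] D_add1 by blast+

lemma D_diff2: "VF Z \<Longrightarrow> VF X \<Longrightarrow> VF Y \<Longrightarrow> D Z (X - Y) = D Z X - D Z Y"
  "VF Z \<Longrightarrow> VF X \<Longrightarrow> D Z (- X) = - D Z X" "VF Z \<Longrightarrow> D Z 0 = 0"
  using additive_on_vf[of "D Z"] D_add2 by blast+

text \<open>The correction added to the Levi-Civita connection is skew with respect to
  \<open>g\<close>: its two contributions, \<eta>(Y)g(\<phi>X,Z) - g(\<phi>X,Y)\<eta>(Z) and the
  same with \<open>Y\<close> and \<open>Z\<close> exchanged, cancel.\<close>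

lemma D_metric: "VF X \<Longrightarrow> VF Y \<Longrightarrow> VF Z \<Longrightarrow> X (g Y Z) = g (D X Y) Z + g Y (D X Z)"
  unfolding D_eq by (simp only: closed nabla_vf nabla_metric linear_simps structure_simps)
    (simp add: fun_eq_iff fun_arith algebra_simps)

lemma D_xi: "VF X \<Longrightarrow> D X \<xi> = \<phi> X + \<phi> X"
  unfolding D_eq by (simp only: closed nabla_xi linear_simps structure_simps)
    (simp add: fun_eq_iff fun_arith)

lemma D_eta: "VF X \<Longrightarrow> VF Y \<Longrightarrow> X (\<eta> Y) = \<eta> (D X Y) + 2 * g (\<phi> X) Y"
  using D_metric[of X Y \<xi>]
  by (simp only: closed D_vf D_xi structure_simps linear_simps)
    (simp add: fun_eq_iff fun_arith)

text \<open>This is the torsion formula solved for the bracket. It serves to eliminate brackets, so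
  that curvature computations involve \<open>D\<close>, \<phi> and \<eta> only.\<close>

lemma lie_eq: "VF X \<Longrightarrow> VF Y \<Longrightarrow> lie X Y = D X Y - D Y X - \<eta> Y \<cdot> \<phi> X + \<eta> X \<cdot> \<phi> Y"
  using nabla_torsion[of X Y] unfolding D_eq
  by (simp only: structure_simps) (simp add: fun_eq_iff fun_arith algebra_simps)

text \<open>The derivative of \<phi> is exactly twice that for the Levi-Civita connection: the
  correction terms reproduce the right side of \<open>nabla_phi\<close> once more.\<close>

lemma D_phi: assumes "VF X" "VF Y"
  shows "D X (\<phi> Y) = \<phi> (D X Y) - (2 * g X Y) \<cdot> \<xi> - (2 * \<eta> Y) \<cdot> X + (4 * \<eta> X * \<eta> Y) \<cdot> \<xi>"
proof -
  have n: "nabla X (\<phi> Y) = \<phi> (nabla X Y) - (g X Y \<cdot> \<xi>) - \<eta> Y \<cdot> X + (2 * \<eta> X * \<eta> Y) \<cdot> \<xi>"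
    using nabla_phi[OF assms] unfolding diff_eq_eq by (simp only: diff_conv_add_uminus ac_simps)
  show ?thesis
    unfolding D_eq n using assms
    by (simp only: closed nabla_vf linear_simps eta_xi phi_xi phi_phi eta_phi g_phi_phi)
      (simp add: fun_eq_iff fun_arith algebra_simps)
qed

lemmas D_simps = D_vf D_add1 D_scale1 D_add2 D_scale2 D_diff1 D_diff2 D_metric D_xi D_eta D_phi
  vf_apply_add vf_apply_diff vf_apply_mult vf_apply_numeral


section \<open>Curvature of the quarter-symmetric connection\<close>

abbreviation R :: "'m tensor13" where "R \<equiv> curvature D"

lemma R_vf: "VF X \<Longrightarrow> VF Y \<Longrightarrow> VF Z \<Longrightarrow> VF (R X Y Z)"
  unfolding curvature_def by (simp only: closed D_vf)

lemma R_add1: "VF X \<Longrightarrow> VF X' \<Longrightarrow> VF Y \<Longrightarrow> VF Z \<Longrightarrow> R (X + X') Y Z = R X Y Z + R X' Y Z"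
  unfolding curvature_def by (simp only: closed D_simps linear_simps lie_eq)
    (simp add: fun_eq_iff fun_arith algebra_simps)

lemma R_add3: "VF X \<Longrightarrow> VF Y \<Longrightarrow> VF Z \<Longrightarrow> VF Z' \<Longrightarrow> R X Y (Z + Z') = R X Y Z + R X Y Z'"
  unfolding curvature_def by (simp only: closed D_simps)
    (simp add: fun_eq_iff fun_arith algebra_simps)

lemma R_skew: "VF X \<Longrightarrow> VF Y \<Longrightarrow> VF Z \<Longrightarrow> R Y X Z = - R X Y Z"
  unfolding curvature_def by (simp only: closed D_simps lie_eq)
    (simp add: fun_eq_iff fun_arith algebra_simps)

lemma R_scale1:
  assumes "SF f" "VF X" "VF Y" "VF Z"
  shows "R (f \<cdot> X) Y Z = f \<cdot> R X Y Z"
  using assms unfolding curvature_def by (simp only: closed D_simps linear_simps lie_eq)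
    (simp add: fun_eq_iff fun_arith algebra_simps)

lemma R_scale3:
  assumes "SF f" "VF X" "VF Y" "VF Z"
  shows "R X Y (f \<cdot> Z) = f \<cdot> R X Y Z"
proof -
  have "lie X Y f = X (Y f) - Y (X f)" by (simp only: lie_def)
  then show ?thesis
    using assms unfolding curvature_def by (simp only: closed D_simps)
      (simp add: fun_eq_iff fun_arith algebra_simps)
qed

lemma R_metric:
  assumes "VF X" "VF Y" "VF Z" "VF W"
  shows "g (R X Y Z) W = - g Z (R X Y W)"
proof -
  have "lie X Y (g Z W) = X (Y (g Z W)) - Y (X (g Z W))" by (simp only: lie_def)
  then show ?thesis
    using assms unfolding curvature_def by (simp only: closed D_simps linear_simps)
      (simp add: fun_eq_iff fun_arith algebra_simps)
qed

text \<open>Origin of the constant 2: as \<open>D X \<xi>\<close> is 2\<phi>X, the derivative of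
  \<phi> contributes 4\<eta>(X)Y - 4\<eta>(Y)X, and 2\<phi> applied to the torsion of
  \<open>X\<close> and \<open>Y\<close> takes half of it back.\<close>

lemma R_xi: "VF X \<Longrightarrow> VF Y \<Longrightarrow> R X Y \<xi> = (2 * \<eta> X) \<cdot> Y - (2 * \<eta> Y) \<cdot> X"
  unfolding curvature_def by (simp only: closed D_simps linear_simps structure_simps lie_eq g_sym[of Y X])
    (simp add: fun_eq_iff fun_arith algebra_simps)

text \<open>For a connection with torsion \<open>T\<close> the cyclic sum is that of T(X,[Y,Z]) +
  D_X(T(Y,Z)), once the Jacobi identity has removed the double brackets. For this \<open>T\<close>
  the remainder cancels, because the derivatives of \<eta> and \<phi> enter through the symmetric
  forms g(\<phi>X,Y) and g(X,Y).\<close>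

lemma first_Bianchi:
  assumes V: "VF X" "VF Y" "VF Z"
  shows "R X Y Z + R Y Z X + R Z X Y = 0"
proof -
  define T where "T X Y = \<eta> Y \<cdot> \<phi> X - \<eta> X \<cdot> \<phi> Y" for X Y
  have Tv: "VF (T X Y)" if "VF X" "VF Y" for X Y unfolding T_def using that by (simp only: closed)
  have dz: "D X Y = D Y X + lie X Y + T X Y" if "VF X" "VF Y" for X Y
    using that by (simp only: lie_eq T_def) (simp add: algebra_simps)
  have a: "D X (D Y Z) = D X (D Z Y) + D X (lie Y Z) + D X (T Y Z)" if "VF X" "VF Y" "VF Z" for X Y Z
    using that by (subst dz[of Y Z]) (simp_all only: closed D_simps Tv)
  have b: "D X (lie Y Z) = D (lie Y Z) X + lie X (lie Y Z) + T X (lie Y Z)"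
    if "VF X" "VF Y" "VF Z" for X Y Z
    using that by (intro dz) (simp_all only: closed)
  have e: "D X (D Y Z) - D X (D Z Y) - D (lie Y Z) X = lie X (lie Y Z) + (T X (lie Y Z) + D X (T Y Z))"
    if "VF X" "VF Y" "VF Z" for X Y Z
    unfolding a[OF that] b[OF that] by (simp add: algebra_simps)
  have "R X Y Z + R Y Z X + R Z X Y =
    (D X (D Y Z) - D X (D Z Y) - D (lie Y Z) X) + (D Y (D Z X) - D Y (D X Z) - D (lie Z X) Y)
    + (D Z (D X Y) - D Z (D Y X) - D (lie X Y) Z)"
    unfolding curvature_def by (simp only: diff_conv_add_uminus ac_simps)
  also have "\<dots> = (lie X (lie Y Z) + lie Y (lie Z X) + lie Z (lie X Y)) +
    (T X (lie Y Z) + D X (T Y Z) + (T Y (lie Z X) + D Y (T Z X)) + (T Z (lie X Y) + D Z (T X Y)))"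
    unfolding e[OF V] e[OF V(2,3,1)] e[OF V(3,1,2)] by (simp only: ac_simps)
  also have "\<dots> = T X (lie Y Z) + D X (T Y Z) + (T Y (lie Z X) + D Y (T Z X)) + (T Z (lie X Y) + D Z (T X Y))"
    unfolding lie_jacobi[OF V] by (simp only: add_0)
  also have "\<dots> = 0"
    unfolding T_def using V
    by (simp only: closed D_simps linear_simps structure_simps lie_eq g_sym[of Z X] g_sym[of Z Y] g_sym[of Y X])
      (simp add: fun_eq_iff fun_arith algebra_simps)
  finally show ?thesis .
qed

end

section \<open>Pair symmetry and the curvature in the direction of \<xi>\<close>

text \<open>The four cyclic identities, one for each choice of the last argument, become after the
  skew symmetries a linear system that implies the claim. The set \<open>A\<close> stands for the
  vector fields, on which alone the identities are known.\<close>

lemma pair_symmetry: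
  fixes K :: "'a \<Rightarrow> 'a \<Rightarrow> 'a \<Rightarrow> 'a \<Rightarrow> real"
  assumes skew12: "\<And>x y z w. x \<in> A \<Longrightarrow> y \<in> A \<Longrightarrow> z \<in> A \<Longrightarrow> w \<in> A \<Longrightarrow> K y x z w = - K x y z w"
    and skew34: "\<And>x y z w. x \<in> A \<Longrightarrow> y \<in> A \<Longrightarrow> z \<in> A \<Longrightarrow> w \<in> A \<Longrightarrow> K x y w z = - K x y z w"
    and cyclic: "\<And>x y z w. x \<in> A \<Longrightarrow> y \<in> A \<Longrightarrow> z \<in> A \<Longrightarrow> w \<in> A \<Longrightarrow> K x y z w + K y z x w + K z x y w = 0"
    and A: "x \<in> A" "y \<in> A" "z \<in> A" "w \<in> A"
  shows "K x y z w = K z w x y"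
  using cyclic[OF A] cyclic[OF A(2,3,4,1)] cyclic[OF A(3,4,1,2)] cyclic[OF A(4,1,2,3)]
    skew34[OF A(2,3,1,4)] skew34[OF A(3,4,1,2)] skew34[OF A(2,4,1,3)] skew34[OF A(1,4,2,3)]
    skew34[OF A(3,1,2,4)] skew34[OF A(1,2,3,4)]
    skew12[OF A(2,4,3,1)] skew12[OF A(1,4,3,2)] skew12[OF A(3,1,4,2)] skew12[OF A(1,4,2,3)]
  by linarith

context para_sasakian_atlas
begin

lemma g_zero_at: "VF V \<Longrightarrow> VF Q \<Longrightarrow> val x V = 0 \<Longrightarrow> g V Q x = 0"
  using one_form_zero_at[OF g_one_form] g_sym by metis

lemma val_zeroI: "VF V \<Longrightarrow> (\<And>Q. VF Q \<Longrightarrow> g V Q x = 0) \<Longrightarrow> val x V = 0"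
  using g_pos[of V x] by (metis less_irrefl)

lemma vf_eqI:
  assumes V: "VF V" "VF V'" and eq: "\<And>Q. VF Q \<Longrightarrow> g V Q = g V' Q"
  shows "V = V'"
proof -
  have "val x (V - V') = 0" for x
    by (rule val_zeroI) (simp_all add: closed V g_diff1 eq fun_arith del: plus_fun_apply)
  then have "(V - V') h x = 0" for h x by (simp add: val_def fun_eq_iff)
  then show ?thesis by (simp add: fun_eq_iff)
qed

lemma R_pair_symmetry:
  assumes "VF X" "VF Y" "VF Z" "VF Q"
  shows "g (R X Y Z) Q = g (R Z Q X) Y"
proof
  fix p
  show "g (R X Y Z) Q p = g (R Z Q X) Y p"
  proof (rule pair_symmetry[of "Collect VF" "\<lambda>X Y Z Q. g (R X Y Z) Q p"])
    fix X Y Z Q assume "X \<in> Collect VF" "Y \<in> Collect VF" "Z \<in> Collect VF" "Q \<in> Collect VF"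
    then have V: "VF X" "VF Y" "VF Z" "VF Q" by auto
    show "g (R Y X Z) Q p = - g (R X Y Z) Q p"
      by (simp only: R_skew[OF V(1-3)] g_diff1 R_vf V uminus_apply)
    show "g (R X Y Q) Z p = - g (R X Y Z) Q p"
      by (simp only: R_metric[OF V] g_sym[OF V(3) R_vf[OF V(1,2,4)]] uminus_apply minus_minus)
    have "g (R X Y Z + R Y Z X + R Z X Y) Q p = 0"
      by (simp only: first_Bianchi[OF V(1-3)] g_diff1 V zero_fun_apply)
    then show "g (R X Y Z) Q p + g (R Y Z X) Q p + g (R Z X Y) Q p = 0"
      by (simp only: g_add1 closed R_vf V plus_fun_apply)
  qed (use assms in auto)
qed

text \<open>Pair symmetry turns g(R(\<xi>,Y)Z,Q) into g(R(Z,Q)\<xi>,Y), where \<xi> occupies the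
  slot covered by \<open>R_xi\<close>.\<close>

lemma R_xi_left:
  assumes "VF Y" "VF Z"
  shows "R \<xi> Y Z = (2 * \<eta> Z) \<cdot> Y - (2 * g Y Z) \<cdot> \<xi>"
proof (rule vf_eqI)
  show "VF (R \<xi> Y Z)" "VF ((2 * \<eta> Z) \<cdot> Y - (2 * g Y Z) \<cdot> \<xi>)"
    using assms by (simp_all only: closed R_vf)
  fix Q assume Q: "VF Q"
  show "g (R \<xi> Y Z) Q = g ((2 * \<eta> Z) \<cdot> Y - (2 * g Y Z) \<cdot> \<xi>) Q"
    using assms Q
    by (simp only: R_pair_symmetry[OF xi_vf assms Q] R_xi closed linear_simps structure_simps
        g_sym[of Q Y] g_sym[of Z Y]) (simp add: fun_eq_iff fun_arith algebra_simps)
qed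

section \<open>The deviation from constant curvature and pseudosymmetry\<close>

abbreviation W :: "'m tensor13" where "W \<equiv> wedge g"

text \<open>The tensor -2W is the curvature of constant sectional curvature -2, so \<open>S\<close>
  measures the deviation from it.\<close>

definition S :: "'m tensor13" where
  "S X Y Z = R X Y Z + 2 \<cdot> W X Y Z"

lemma W_vf: "VF X \<Longrightarrow> VF Y \<Longrightarrow> VF Z \<Longrightarrow> VF (W X Y Z)"
  unfolding wedge_def by (simp only: closed)

lemma S_vf: "VF X \<Longrightarrow> VF Y \<Longrightarrow> VF Z \<Longrightarrow> VF (S X Y Z)"
  unfolding S_def by (simp only: closed W_vf R_vf)

lemma S_add1: "VF X \<Longrightarrow> VF X' \<Longrightarrow> VF Y \<Longrightarrow> VF Z \<Longrightarrow> S (X + X') Y Z = S X Y Z + S X' Y Z"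
  unfolding S_def wedge_def by (simp only: R_add1 linear_simps)
    (simp add: fun_eq_iff fun_arith algebra_simps)

lemma S_scale1: "SF f \<Longrightarrow> VF X \<Longrightarrow> VF Y \<Longrightarrow> VF Z \<Longrightarrow> S (f \<cdot> X) Y Z = f \<cdot> S X Y Z"
  unfolding S_def wedge_def by (simp only: R_scale1 linear_simps)
    (simp add: fun_eq_iff fun_arith algebra_simps)

lemma S_skew: "VF X \<Longrightarrow> VF Y \<Longrightarrow> VF Z \<Longrightarrow> S Y X Z = - S X Y Z"
  unfolding S_def wedge_def R_skew[of X Y Z]
  by (simp add: fun_eq_iff fun_arith algebra_simps)

lemma S_xi: "VF Y \<Longrightarrow> VF Z \<Longrightarrow> S \<xi> Y Z = 0"
  unfolding S_def wedge_def by (simp only: R_xi_left structure_simps)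
    (simp add: fun_eq_iff fun_arith algebra_simps)

lemma R_diff3: "VF X \<Longrightarrow> VF Y \<Longrightarrow> VF Z \<Longrightarrow> VF Z' \<Longrightarrow> R X Y (Z - Z') = R X Y Z - R X Y Z'"
  using additive_on_vf(1)[of "R X Y"] R_add3 by blast

lemma R_scale2:
  assumes V: "SF f" "VF X" "VF Y" "VF Z"
  shows "R X (f \<cdot> Y) Z = f \<cdot> R X Y Z"
  using R_skew[OF vf_scale[OF V(3,1)] V(2,4)] R_scale1[OF V(1,3,2,4)] R_skew[OF V(2,3,4)]
  by (simp only:) (simp add: fun_eq_iff fun_arith)

text \<open>Since W(\<xi>,Y)\<xi> = \<eta>(Y)\<xi> - Y, the last term of the derivation contributes
  R(U,V)Y. Everything else contains the curvature applied to \<xi>, is explicit by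
  \<open>R_xi\<close>, and adds up to 2W(U,V)Y.\<close>

lemma deriv_wedge_xi:
  assumes "VF Y" "VF U" "VF V"
  shows "deriv_action (W \<xi> Y) R U V \<xi> = S U V Y"
  using assms unfolding deriv_action_def S_def wedge_def
  by (simp only: closed R_vf R_xi R_diff3 R_scale3 linear_simps structure_simps g_sym[of V Y] g_sym[of U Y])
    (simp add: fun_eq_iff fun_arith algebra_simps)

lemma R_xi_left': "VF Y \<Longrightarrow> VF Z \<Longrightarrow> R \<xi> Y Z = (- 2) \<cdot> W \<xi> Y Z"
  unfolding wedge_def by (simp only: R_xi_left structure_simps)
    (simp add: fun_eq_iff fun_arith algebra_simps)

text \<open>The endomorphism also appears inside the three slots of \<open>R\<close>, so
  tensoriality in each of them is what lets the factor -2 out.\<close>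

lemma deriv_R_xi:
  assumes V: "VF Y" "VF U" "VF V" "VF Z"
  shows "deriv_action (R \<xi> Y) R U V Z = (- 2) \<cdot> deriv_action (W \<xi> Y) R U V Z"
proof -
  have "R \<xi> Y (R U V Z) = (- 2) \<cdot> W \<xi> Y (R U V Z)"
    using V by (intro R_xi_left' R_vf)
  moreover have "R (R \<xi> Y U) V Z = (- 2) \<cdot> R (W \<xi> Y U) V Z"
    using V by (simp only: R_xi_left' R_scale1 closed W_vf)
  moreover have "R U (R \<xi> Y V) Z = (- 2) \<cdot> R U (W \<xi> Y V) Z"
    using V by (simp only: R_xi_left' R_scale2 closed W_vf)
  moreover have "R U V (R \<xi> Y Z) = (- 2) \<cdot> R U V (W \<xi> Y Z)"
    using V by (simp only: R_xi_left' R_scale3 closed W_vf)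
  ultimately show ?thesis
    unfolding deriv_action_def by (simp only:) (simp add: fun_eq_iff fun_arith algebra_simps)
qed

lemma pseudosymmetric_defect:
  assumes ps: "pseudosymmetric \<A> g D L" and x: "x \<in> curvature_support \<A> D" "L x \<noteq> -2"
    and V: "VF U" "VF V" "VF Y"
  shows "val x (S U V Y) = 0"
proof
  fix h
  have "val x (deriv_action (R \<xi> Y) R U V \<xi>) h = L x * val x (deriv_action (W \<xi> Y) R U V \<xi>) h"
    using ps x(1) V xi_vf unfolding pseudosymmetric_def by blast
  then have "- 2 * S U V Y h x = L x * S U V Y h x"
    unfolding deriv_R_xi[OF V(3,1,2) xi_vf] deriv_wedge_xi[OF V(3,1,2)]
    by (simp add: val_def fun_arith)
  then have "(L x + 2) * S U V Y h x = 0" by (simp add: algebra_simps)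
  then show "val x (S U V Y) h = 0 h" using x(2) by (simp add: val_def)
qed

text \<open>The set is a union of nonvanishing sets of the continuous functions
  \<open>R X Y Z h\<close>.\<close>

lemma open_curvature_support: "open (curvature_support \<A> D)"
proof -
  have "curvature_support \<A> D =
    (\<Union>X\<in>Collect VF. \<Union>Y\<in>Collect VF. \<Union>Z\<in>Collect VF. \<Union>h. {x. R X Y Z h x \<noteq> 0})"
    unfolding curvature_support_def by (simp add: val_def fun_eq_iff) blast
  moreover have "open {x. R X Y Z h x \<noteq> 0}" if "VF X" "VF Y" "VF Z" for X Y Z h
    using smooth_fun_continuous[OF vf_smooth'[OF R_vf[OF that]], of h]
    by (intro open_Collect_neq continuous_on_const)
  ultimately show ?thesis by (simp add: open_UN)
qed


section \<open>Constant curvature on an open set\<close>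

text \<open>This differentiates the equation \<open>\<eta> Z = 0\<close>, which is why horizontality
  is demanded of the field everywhere and not just at one point.\<close>

lemma horizontal_eta_D:
  assumes "VF X" "VF Z" "\<eta> Z = 0"
  shows "\<eta> (D X Z) = - (2 * g (\<phi> X) Z)"
  using D_eta[OF assms(1,2)] vf_apply_numeral(3)[OF assms(1)] assms(3)
  by (simp only: eq_neg_iff_add_eq_0)

text \<open>The factor is 6 = 4 + 2. Differentiating \<open>D_phi\<close> once more makes the
  commutator of \<open>R\<close> with \<phi> 4 times the bracket on the right, the torsion of two
  horizontal fields being 0; the commutator of \<open>W\<close> with \<phi> is that bracket itself
  and enters \<open>S\<close> twice.\<close>

lemma defect_phi:
  assumes "VF X" "VF Y" "VF Z" "\<eta> X = 0" "\<eta> Y = 0" "\<eta> Z = 0"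
  shows "S X Y (\<phi> Z) - \<phi> (S X Y Z) =
    6 \<cdot> (g (\<phi> Y) Z \<cdot> X - g (\<phi> X) Z \<cdot> Y - g Y Z \<cdot> \<phi> X + g X Z \<cdot> \<phi> Y)"
  using assms unfolding S_def wedge_def curvature_def
  by (simp only: closed D_simps linear_simps structure_simps lie_eq horizontal_eta_D)
    (simp add: fun_eq_iff fun_arith algebra_simps)

text \<open>The cyclic sum in X, Y, Z is the exterior covariant derivative of \<open>T\<close> as an
  endomorphism-valued 2-form. Written with brackets instead of derivatives of \<open>Y\<close> and
  \<open>Z\<close>, it makes no reference to the torsion.\<close>

definition Bianchi_term :: "'m tensor13 \<Rightarrow> 'm vfield \<Rightarrow> 'm vfield \<Rightarrow> 'm vfield \<Rightarrow> 'm vfield \<Rightarrow> 'm vfield" where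
  "Bianchi_term T X Y Z Q = D X (T Y Z Q) - T Y Z (D X Q) + T X (lie Y Z) Q"

text \<open>The triple derivatives cancel in the cyclic sum, and what is left is the derivative of
  \<open>Q\<close> along the Jacobi sum of brackets.\<close>

lemma second_Bianchi:
  assumes V: "VF X" "VF Y" "VF Z" "VF Q"
  shows "Bianchi_term R X Y Z Q + Bianchi_term R Y Z X Q + Bianchi_term R Z X Y Q = 0"
proof -
  have "D (lie X (lie Y Z) + lie Y (lie Z X) + lie Z (lie X Y)) Q = 0"
    unfolding lie_jacobi[OF V(1-3)] using V by (simp only: D_diff1)
  then have J: "D (lie X (lie Y Z)) Q + D (lie Y (lie Z X)) Q + D (lie Z (lie X Y)) Q = 0"
    using V by (simp only: D_add1 closed)
  have "Bianchi_term R X Y Z Q + Bianchi_term R Y Z X Q + Bianchi_term R Z X Y Q =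
    - (D (lie X (lie Y Z)) Q + D (lie Y (lie Z X)) Q + D (lie Z (lie X Y)) Q)"
    using V unfolding Bianchi_term_def curvature_def
    by (simp only: closed D_vf D_diff2 D_add2) (simp add: fun_eq_iff fun_arith algebra_simps)
  then show ?thesis unfolding J by (simp only: minus_zero)
qed

lemma Bianchi_defect:
  assumes V: "VF X" "VF Y" "VF Z" "VF Q"
  shows "Bianchi_term S X Y Z Q = Bianchi_term R X Y Z Q + 2 \<cdot> Bianchi_term W X Y Z Q"
  using V unfolding Bianchi_term_def S_def
  by (simp only: closed D_vf R_vf W_vf D_add2 D_scale2 vf_apply_numeral)
    (simp add: fun_eq_iff fun_arith algebra_simps)

text \<open>As \<open>g\<close> is parallel, \<open>W\<close> is too, and only the torsion
  \<open>T\<close> contributes: the sum is W(T(\<xi>,X),Y) + W(T(X,Y),\<xi>) + W(T(Y,\<xi>),X). For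
  horizontal fields T(X,Y) = 0 and T(Y,\<xi>) = \<phi>Y, which leaves W(\<phi>Y,X) -
  W(\<phi>X,Y).\<close>

lemma Bianchi_wedge_xi:
  assumes V: "VF X" "VF Y" "VF Q" "\<eta> X = 0" "\<eta> Y = 0"
  shows "Bianchi_term W \<xi> X Y Q + Bianchi_term W X Y \<xi> Q + Bianchi_term W Y \<xi> X Q =
    - (g (\<phi> Y) Q \<cdot> X - g X Q \<cdot> \<phi> Y - g (\<phi> X) Q \<cdot> Y + g Y Q \<cdot> \<phi> X)"
  using V unfolding Bianchi_term_def wedge_def
  by (simp only: closed D_simps linear_simps structure_simps lie_eq horizontal_eta_D)
    (simp add: fun_eq_iff fun_arith algebra_simps)


section \<open>Dimension and Einstein condition\<close>

lemma horizontal_parallel: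
  assumes N: "open N" "x \<in> N"
    and S0: "\<And>A B C y. VF A \<Longrightarrow> VF B \<Longrightarrow> VF C \<Longrightarrow> y \<in> N \<Longrightarrow> val y (S A B C) = 0"
    and X: "VF X" "\<eta> X = 0" and Y: "VF Y" "\<eta> Y = 0"
  shows "val x (g Y Y \<cdot> X - g X Y \<cdot> Y) = 0"
proof (rule val_zeroI)
  show "VF (g Y Y \<cdot> X - g X Y \<cdot> Y)" using X Y by (simp only: closed)
  fix P assume P: "VF P"
  \<comment> \<open>With this choice g(\<phi>Y,Q) and g(\<phi>X,Q) become g(Y,Y) and g(X,Y), by
    compatibility of \<open>g\<close> with \<phi> on horizontal fields.\<close>
  let ?Q = "\<phi> Y"
  have Q: "VF ?Q" "\<eta> ?Q = 0" using Y by (simp_all only: closed structure_simps)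
  have gS: "g (S A B C) V y = 0" if "VF A" "VF B" "VF C" "VF V" "y \<in> N" for A B C V y
    by (rule g_zero_at) (simp_all only: S_vf S0 that)
  \<comment> \<open>Symmetry of \<phi> moves it from \<open>S\<close> to \<open>P\<close>, so that
    the vanishing of \<open>S\<close> at \<open>x\<close> applies directly.\<close>
  have "g (S X Y (\<phi> ?Q) - \<phi> (S X Y ?Q)) P = g (S X Y (\<phi> ?Q)) P - g (S X Y ?Q) (\<phi> P)"
    using X Y Q P by (simp only: closed S_vf linear_simps g_phi)
  then have "g (S X Y (\<phi> ?Q) - \<phi> (S X Y ?Q)) P x = 0"
    using gS[OF X(1) Y(1) phi_vf[OF Q(1)] P N(2)] gS[OF X(1) Y(1) Q(1) phi_vf[OF P] N(2)]
    by (simp only: minus_apply diff_self)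
  then have a: "6 * (g (\<phi> Y) ?Q x * g X P x - g (\<phi> X) ?Q x * g Y P x - g Y ?Q x * g (\<phi> X) P x
      + g X ?Q x * g (\<phi> Y) P x) = 0"
    unfolding defect_phi[OF X(1) Y(1) Q(1) X(2) Y(2) Q(2)] using X(1) Y(1) Q(1) P
    by (simp only: closed linear_simps) (simp only: fun_arith)
  have BS: "g (Bianchi_term S A B C V) P x = 0" if "VF A" "VF B" "VF C" "VF V" for A B C V
  proof -
    \<comment> \<open>A derivative of \<open>S\<close> occurs here, and this is where vanishing on a
      whole neighbourhood enters; metricity then passes the result to the covariant
      derivative.\<close>
    have "A (g (S B C V) P) x = 0"
      by (rule vf_apply_zero_at[OF that(1) g_smooth N]) (simp_all only: S_vf that P gS)
    then have "g (D A (S B C V)) P x = 0"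
      using gS[OF that(2,3,4) D_vf[OF that(1) P] N(2)]
      by (simp only: D_metric[OF that(1) S_vf[OF that(2-4)] P] plus_fun_apply add_0_right)
    then show ?thesis
      unfolding Bianchi_term_def
      using that P gS[OF that(2,3) D_vf[OF that(1,4)] P N(2)] gS[OF that(1) vf_lie[OF that(2,3)] that(4) P N(2)]
      by (simp only: closed D_vf S_vf linear_simps fun_arith)
  qed
  have "Bianchi_term S \<xi> X Y ?Q + Bianchi_term S X Y \<xi> ?Q + Bianchi_term S Y \<xi> X ?Q =
    (Bianchi_term R \<xi> X Y ?Q + Bianchi_term R X Y \<xi> ?Q + Bianchi_term R Y \<xi> X ?Q) +
    2 \<cdot> (Bianchi_term W \<xi> X Y ?Q + Bianchi_term W X Y \<xi> ?Q + Bianchi_term W Y \<xi> X ?Q)"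
    using X(1) Y(1) Q(1) xi_vf by (simp only: Bianchi_defect) (simp add: fun_eq_iff fun_arith)
  also have "\<dots> = (- 2) \<cdot> (g (\<phi> Y) ?Q \<cdot> X - g X ?Q \<cdot> \<phi> Y - g (\<phi> X) ?Q \<cdot> Y + g Y ?Q \<cdot> \<phi> X)"
    unfolding second_Bianchi[OF xi_vf X(1) Y(1) Q(1)] Bianchi_wedge_xi[OF X(1) Y(1) Q(1) X(2) Y(2)]
    by (simp add: fun_eq_iff fun_arith algebra_simps)
  finally have e: "g (Bianchi_term S \<xi> X Y ?Q + Bianchi_term S X Y \<xi> ?Q + Bianchi_term S Y \<xi> X ?Q) P =
    g ((- 2) \<cdot> (g (\<phi> Y) ?Q \<cdot> X - g X ?Q \<cdot> \<phi> Y - g (\<phi> X) ?Q \<cdot> Y + g Y ?Q \<cdot> \<phi> X)) P"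
    by (rule arg_cong)
  have bv: "VF (Bianchi_term S A B C V)" if "VF A" "VF B" "VF C" "VF V" for A B C V
    unfolding Bianchi_term_def using that by (simp only: closed D_vf S_vf)
  have "g (Bianchi_term S \<xi> X Y ?Q + Bianchi_term S X Y \<xi> ?Q + Bianchi_term S Y \<xi> X ?Q) P x = 0"
    using X(1) Y(1) Q(1) xi_vf P by (simp only: linear_simps bv closed plus_fun_apply BS add_0)
  then have "- 2 * (g (\<phi> Y) ?Q x * g X P x - g X ?Q x * g (\<phi> Y) P x - g (\<phi> X) ?Q x * g Y P x
      + g Y ?Q x * g (\<phi> X) P x) = 0"
    unfolding e using X(1) Y(1) Q(1) P
    by (simp only: closed linear_simps) (simp only: fun_arith)
  \<comment> \<open>Adding the two relations removes the terms in \<phi>X and \<phi>Y.\<close>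
  with a have "g (\<phi> Y) ?Q x * g X P x = g (\<phi> X) ?Q x * g Y P x"
    by (simp add: algebra_simps)
  moreover have "g (\<phi> Y) ?Q = g Y Y" "g (\<phi> X) ?Q = g X Y"
    using X Y by (simp_all only: g_phi_phi mult_zero_left mult_zero_right diff_zero)
  moreover have "g (g Y Y \<cdot> X - g X Y \<cdot> Y) P x = g Y Y x * g X P x - g X Y x * g Y P x"
    using X(1) Y(1) P by (simp only: closed linear_simps) (simp only: fun_arith)
  ultimately show "g (g Y Y \<cdot> X - g X Y \<cdot> Y) P x = 0" by (simp only: diff_self)
qed

lemma horizontal_part:
  assumes "VF X"
  shows "VF (X - \<eta> X \<cdot> \<xi>)" "\<eta> (X - \<eta> X \<cdot> \<xi>) = 0"
  using assms by (simp_all only: closed linear_simps structure_simps mult_1_right diff_self)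

lemma frame_coefficients:
  assumes "frame_at \<A> x (E :: 'n \<Rightarrow> 'm vfield)"
  obtains c where "\<And>X h. VF X \<Longrightarrow> X h x = (\<Sum>i\<in>UNIV. c X $ i * E i h x)"
    "\<And>X d. VF X \<Longrightarrow> \<forall>h. X h x = (\<Sum>i\<in>UNIV. d $ i * E i h x) \<Longrightarrow> c X = d"
    "\<And>i. VF (E i)"
proof -
  have ex: "\<exists>!c::real^'n. \<forall>h. X h x = (\<Sum>i\<in>UNIV. c $ i * E i h x)" if "VF X" for X
    using assms that unfolding frame_at_def val_def by blast
  define c where "c X = (THE c::real^'n. \<forall>h. X h x = (\<Sum>i\<in>UNIV. c $ i * E i h x))" for X
  show ?thesis
  proof
    show "X h x = (\<Sum>i\<in>UNIV. c X $ i * E i h x)" if "VF X" for X h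
      using theI'[OF ex[OF that]] unfolding c_def by blast
    show "c X = d" if "VF X" "\<forall>h. X h x = (\<Sum>i\<in>UNIV. d $ i * E i h x)" for X d
      unfolding c_def by (rule the1_equality[OF ex[OF that(1)] that(2)])
    show "VF (E i)" for i using assms unfolding frame_at_def by blast
  qed
qed

text \<open>Coefficients with respect to a frame identify tangent vectors at \<open>x\<close> with
  \<open>real^'n\<close> and send the frame to the standard basis, so two generating vectors span
  the whole space.\<close>

lemma card_le_2:
  assumes Y: "VF Y" "VF Y'" and sp: "\<And>Z. VF Z \<Longrightarrow> \<exists>\<alpha> \<beta>. \<forall>h. Z h x = \<alpha> * Y h x + \<beta> * Y' h x"
  shows "CARD('n) \<le> 2"
proof -
  obtain E :: "'n \<Rightarrow> 'm vfield" where "frame_at \<A> x E" using ex_frame_at by blast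
  then obtain c where c: "\<And>X h. VF X \<Longrightarrow> X h x = (\<Sum>i\<in>UNIV. c X $ i * E i h x)"
    "\<And>X d. VF X \<Longrightarrow> \<forall>h. X h x = (\<Sum>i\<in>UNIV. d $ i * E i h x) \<Longrightarrow> c X = d"
    "\<And>i. VF (E i)"
    by (rule frame_coefficients) (rule that)
  have "c Z \<in> span {c Y, c Y'}" if Z: "VF Z" for Z
  proof -
    obtain \<alpha> \<beta> where ab: "\<And>h. Z h x = \<alpha> * Y h x + \<beta> * Y' h x" using sp[OF Z] by blast
    have "c Z = \<alpha> *\<^sub>R c Y + \<beta> *\<^sub>R c Y'"
    proof (rule c(2)[OF Z], rule allI)
      fix h
      show "Z h x = (\<Sum>i\<in>UNIV. (\<alpha> *\<^sub>R c Y + \<beta> *\<^sub>R c Y') $ i * E i h x)"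
        unfolding ab[of h] c(1)[OF Y(1)] c(1)[OF Y(2)]
        by (simp add: sum_distrib_left algebra_simps sum.distrib)
    qed
    then show ?thesis by (auto intro: span_add span_scale span_base)
  qed
  moreover have "c (E j) = axis j 1" for j
    by (rule c(2)[OF c(3)]) (simp add: axis_def if_distrib[of "\<lambda>z. z * _"] cong: if_cong)
  ultimately have "axis j 1 \<in> span {c Y, c Y'}" for j using c(3)[of j] by metis
  then have "(\<Sum>j\<in>UNIV. v $ j *\<^sub>R axis j 1) \<in> span {c Y, c Y'}" for v :: "real^'n"
    by (intro span_sum span_scale)
  then have "(UNIV :: (real^'n) set) \<subseteq> span {c Y, c Y'}"
    using basis_expansion[where 'a=real and 'n='n] by (auto simp: scalar_mult_eq_scaleR)
  then have "dim (UNIV :: (real^'n) set) \<le> card {c Y, c Y'}" by (rule dim_le_card) simp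
  also have "\<dots> \<le> 2" by (simp add: card_insert_if)
  finally show ?thesis by simp
qed

lemma card_le_2_if_constant_curvature:
  assumes N: "open N" "x \<in> N"
    and S0: "\<And>A B C y. VF A \<Longrightarrow> VF B \<Longrightarrow> VF C \<Longrightarrow> y \<in> N \<Longrightarrow> val y (S A B C) = 0"
  shows "CARD('n) \<le> 2"
proof (cases "\<exists>Y. VF Y \<and> \<eta> Y = 0 \<and> val x Y \<noteq> 0")
  case True
  then obtain Y where Y: "VF Y" "\<eta> Y = 0" "val x Y \<noteq> 0" by blast
  have pos: "g Y Y x > 0" by (rule g_pos[OF Y(1,3)])
  have "\<exists>\<alpha> \<beta>. \<forall>h. Z h x = \<alpha> * \<xi> h x + \<beta> * Y h x" if Z: "VF Z" for Z
  proof (intro exI allI)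
    fix h
    let ?Z = "Z - \<eta> Z \<cdot> \<xi>"
    have "val x (g Y Y \<cdot> ?Z - g ?Z Y \<cdot> Y) h = 0"
      using horizontal_parallel[OF N S0 horizontal_part[OF Z] Y(1,2)] by (simp add: fun_eq_iff)
    then have "g Y Y x * (Z h x - \<eta> Z x * \<xi> h x) = g ?Z Y x * Y h x"
      by (simp add: val_def fun_arith)
    then show "Z h x = \<eta> Z x * \<xi> h x + (g ?Z Y x / g Y Y x) * Y h x"
      using pos by (simp add: field_simps)
  qed
  then show ?thesis by (rule card_le_2[OF xi_vf Y(1)])
next
  case False
  \<comment> \<open>If all horizontal fields vanish at \<open>x\<close>, every tangent vector there
    is a multiple of \<xi>; the second generator is a mere repetition.\<close>
  have "\<exists>\<alpha> \<beta>. \<forall>h. Z h x = \<alpha> * \<xi> h x + \<beta> * \<xi> h x" if Z: "VF Z" for Z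
  proof (intro exI allI)
    fix h
    have "val x (Z - \<eta> Z \<cdot> \<xi>) h = 0" using False horizontal_part[OF Z] by (auto simp: fun_eq_iff)
    then show "Z h x = \<eta> Z x * \<xi> h x + 0 * \<xi> h x" by (simp add: val_def fun_arith)
  qed
  then show ?thesis by (rule card_le_2[OF xi_vf xi_vf])
qed

section \<open>Curvature in dimension at most two\<close>

lemma dependent_at:
  assumes n: "CARD('n) \<le> 2" and V: "VF X" "VF Y" "VF Z"
  obtains \<alpha> \<beta> \<gamma> where "\<alpha> \<noteq> 0 \<or> \<beta> \<noteq> 0 \<or> \<gamma> \<noteq> 0" "\<And>h. \<alpha> * X h x + \<beta> * Y h x + \<gamma> * Z h x = 0"
proof -
  obtain E :: "'n \<Rightarrow> 'm vfield" where "frame_at \<A> x E" using ex_frame_at by blast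
  then obtain c where c: "\<And>X h. VF X \<Longrightarrow> X h x = (\<Sum>i\<in>UNIV. c X $ i * E i h x)"
    "\<And>X d. VF X \<Longrightarrow> \<forall>h. X h x = (\<Sum>i\<in>UNIV. d $ i * E i h x) \<Longrightarrow> c X = d"
    "\<And>i. VF (E i)"
    by (rule frame_coefficients) (rule that)
  define f :: "real^3 \<Rightarrow> real^'n" where
    "f v = v $ 1 *\<^sub>R c X + v $ 2 *\<^sub>R c Y + v $ 3 *\<^sub>R c Z" for v
  have f: "linear f" unfolding f_def by (rule linearI) (simp_all add: algebra_simps)
  have "\<not> inj f"
  proof
    assume "inj f"
    then have "dim (f ` UNIV) = dim (UNIV :: (real^3) set)"
      by (intro dim_image_eq[OF f]) (auto intro: inj_on_subset)
    then have "3 \<le> DIM(real^'n)" using dim_subset_UNIV[of "f ` UNIV"] by simp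
    then show False using n by simp
  qed
  then obtain v where v: "f v = 0" "v \<noteq> 0" using linear_injective_0[OF f] by blast
  have "v $ 1 \<noteq> 0 \<or> v $ 2 \<noteq> 0 \<or> v $ 3 \<noteq> 0"
    using v(2) by (simp add: vec_eq_iff forall_3)
  moreover have "v $ 1 * X h x + v $ 2 * Y h x + v $ 3 * Z h x = 0" for h
  proof -
    have "v $ 1 * X h x + v $ 2 * Y h x + v $ 3 * Z h x = (\<Sum>i\<in>UNIV. f v $ i * E i h x)"
      unfolding c(1)[OF V(1)] c(1)[OF V(2)] c(1)[OF V(3)] f_def
      by (simp add: sum_distrib_left algebra_simps sum.distrib)
    then show ?thesis by (simp add: v(1))
  qed
  ultimately show ?thesis by (rule that)
qed

text \<open>\<open>S\<close> is alternating in its first two arguments and annihilated by \<xi>, so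
  it depends only on the horizontal parts of \<open>X\<close> and \<open>Y\<close>; these are
  linearly dependent at each point, the complement of \<xi> being at most a line.\<close>

lemma S_zero_if_card_le_2:
  assumes n: "CARD('n) \<le> 2" and V: "VF X" "VF Y" "VF Z"
  shows "S X Y Z = 0"
proof -
  let ?X = "X - \<eta> X \<cdot> \<xi>" and ?Y = "Y - \<eta> Y \<cdot> \<xi>"
  note X' = horizontal_part[OF V(1)] and Y' = horizontal_part[OF V(2)]
  have red: "S A B Z = S (A - \<eta> A \<cdot> \<xi>) B Z" if "VF A" "VF B" for A B
  proof -
    have "S ((A - \<eta> A \<cdot> \<xi>) + \<eta> A \<cdot> \<xi>) B Z = S (A - \<eta> A \<cdot> \<xi>) B Z + \<eta> A \<cdot> S \<xi> B Z"
      using that V(3) by (simp only: S_add1 S_scale1 closed)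
    then show ?thesis
      unfolding S_xi[OF that(2) V(3)] by (simp add: fun_eq_iff fun_arith del: plus_fun_apply)
        (simp add: fun_scale_def)
  qed
  have "S X Y Z = S ?X Y Z" by (rule red[OF V(1,2)])
  also have "\<dots> = - S Y ?X Z" by (rule S_skew[OF V(2) X'(1) V(3)])
  also have "\<dots> = - S ?Y ?X Z" unfolding red[OF V(2) X'(1)] ..
  also have "\<dots> = S ?X ?Y Z" by (rule S_skew[OF Y'(1) X'(1) V(3), symmetric])
  also have "\<dots> = 0"
  proof (rule vf_eqI)
    show "VF (S ?X ?Y Z)" by (rule S_vf[OF X'(1) Y'(1) V(3)])
    show "VF 0" by (rule vf_zero)
    fix Q assume Q: "VF Q"
    show "g (S ?X ?Y Z) Q = g 0 Q"
    proof
      fix x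
      obtain \<alpha> \<beta> \<gamma> where nz: "\<alpha> \<noteq> 0 \<or> \<beta> \<noteq> 0 \<or> \<gamma> \<noteq> 0"
        and dep: "\<And>h. \<alpha> * ?X h x + \<beta> * ?Y h x + \<gamma> * \<xi> h x = 0"
        by (rule dependent_at[OF n X'(1) Y'(1) xi_vf, of x]) (rule that)
      \<comment> \<open>Constant coefficients turn the dependence of the values at \<open>x\<close>
        into a global field vanishing there, to which one-forms can be applied.\<close>
      let ?V = "(\<lambda>_. \<alpha>) \<cdot> ?X + (\<lambda>_. \<beta>) \<cdot> ?Y + (\<lambda>_. \<gamma>) \<cdot> \<xi>"
      have cv: "VF ((\<lambda>_. k) \<cdot> A)" if "VF A" for k A using vf_scale[OF that smooth_fun_const] .
      have Vv: "VF ?V" by (intro vf_add cv X'(1) Y'(1) xi_vf)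
      have V0: "val x ?V = 0"
        using dep by (simp add: val_def fun_eq_iff fun_scale_def)
      have form: "\<omega> ?V x = \<alpha> * \<omega> ?X x + \<beta> * \<omega> ?Y x + \<gamma> * \<omega> \<xi> x" if "one_form \<A> \<omega>" for \<omega>
      proof -
        have "\<omega> ?V = \<omega> ((\<lambda>_. \<alpha>) \<cdot> ?X) + \<omega> ((\<lambda>_. \<beta>) \<cdot> ?Y) + \<omega> ((\<lambda>_. \<gamma>) \<cdot> \<xi>)"
          using that cv X'(1) Y'(1) xi_vf vf_add unfolding one_form_def by simp
        also have "\<dots> = (\<lambda>_. \<alpha>) * \<omega> ?X + (\<lambda>_. \<beta>) * \<omega> ?Y + (\<lambda>_. \<gamma>) * \<omega> \<xi>"
          using that X'(1) Y'(1) xi_vf smooth_fun_const unfolding one_form_def by simp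
        finally show ?thesis by simp
      qed
      \<comment> \<open>Pairing with \<xi> removes the horizontal parts, so the dependence is
        between those two alone.\<close>
      have "\<gamma> = 0"
        using form[OF g_one_form[OF xi_vf]] one_form_zero_at[OF g_one_form[OF xi_vf] Vv V0]
        by (simp only: g_xi1 X' Y' xi_vf eta_xi) simp
      have of: "one_form \<A> (\<lambda>A. g (S A B Z) Q)" if B: "VF B" for B
        using B V(3) Q unfolding one_form_def
        by (simp only: mem_Collect_eq Ball_Collect[symmetric] S_vf g_smooth S_add1 S_scale1 linear_simps)
          (simp add: S_vf g_smooth S_add1 S_scale1 g_add1 g_scale1 del: plus_fun_apply)
      have self: "g (S B B Z) Q x = 0" if B: "VF B" for B
      proof -
        have "g (S B B Z) Q = g (- S B B Z) Q"
          using arg_cong[OF S_skew[OF B B V(3)], of "\<lambda>V. g V Q"] .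
        also have "\<dots> = - g (S B B Z) Q" by (rule g_diff1(2)[OF Q S_vf[OF B B V(3)]])
        finally have "g (S B B Z) Q = - g (S B B Z) Q" .
        from fun_cong[OF this, of x] have "g (S B B Z) Q x = - g (S B B Z) Q x"
          by (simp only: uminus_apply)
        then show ?thesis by simp
      qed
      have xi0: "g (S \<xi> B Z) Q x = 0" if "VF B" for B
        using S_xi[OF that V(3)] g_diff1(3)[OF Q] by simp
      \<comment> \<open>The vanishing combination is inserted into the first slot of
        \<open>S\<close>; repeated arguments and \<xi> contribute 0.\<close>
      have "\<alpha> * g (S ?X ?Y Z) Q x = 0"
        using form[OF of[OF Y'(1)]] one_form_zero_at[OF of[OF Y'(1)] Vv V0] self[OF Y'(1)] xi0[OF Y'(1)]
        by simp
      moreover have "\<beta> * g (S ?Y ?X Z) Q x = 0"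
        using form[OF of[OF X'(1)]] one_form_zero_at[OF of[OF X'(1)] Vv V0] self[OF X'(1)] xi0[OF X'(1)]
        by simp
      moreover have "g (S ?Y ?X Z) Q = - g (S ?X ?Y Z) Q"
        using S_skew[OF X'(1) Y'(1) V(3)] g_diff1(2)[OF Q S_vf[OF X'(1) Y'(1) V(3)]] by simp
      ultimately have "g (S ?X ?Y Z) Q x = 0" using nz \<open>\<gamma> = 0\<close> by auto
      then show "g (S ?X ?Y Z) Q x = g 0 Q x" by (simp only: g_diff1(3)[OF Q] zero_fun_apply)
    qed
  qed
  finally show ?thesis .
qed

section \<open>The Ricci tensor for constant curvature\<close>

text \<open>In -2(g(Y,Z)X - g(X,Z)Y), as a map of \<open>X\<close>, the first term in parentheses
  has trace n g(Y,Z) and the rank-one second term has trace g(Y,Z), whence the factor n - 1.\<close>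

lemma einstein_if_constant_curvature:
  assumes S0: "\<And>X Y Z. VF X \<Longrightarrow> VF Y \<Longrightarrow> VF Z \<Longrightarrow> S X Y Z = 0"
  shows "einstein \<A> g D"
  unfolding einstein_def
proof (intro exI ballI allI)
  fix Y Z x assume "Y \<in> Collect VF" "Z \<in> Collect VF"
  then have V: "VF Y" "VF Z" by auto
  have RW: "R X Y Z h x = - 2 * g Y Z x * X h x + 2 * g X Z x * Y h x" if "VF X" for X h
  proof -
    have "S X Y Z h x = 0" using S0[OF that V] by simp
    then show ?thesis by (simp add: S_def wedge_def fun_arith algebra_simps)
  qed
  have tr: "trace C = - 2 * (real CARD('n) - 1) * g Y Z x"
    if fr: "frame_at \<A> x E" and C: "\<forall>j h. val x (R (E j) Y Z) h = (\<Sum>i\<in>UNIV. C $ i $ j * val x (E i) h)"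
    for E :: "'n \<Rightarrow> 'm vfield" and C :: "real^'n^'n"
  proof -
    obtain c where c: "\<And>X h. VF X \<Longrightarrow> X h x = (\<Sum>i\<in>UNIV. c X $ i * E i h x)"
      "\<And>X d. VF X \<Longrightarrow> \<forall>h. X h x = (\<Sum>i\<in>UNIV. d $ i * E i h x) \<Longrightarrow> c X = d"
      "\<And>i. VF (E i)"
      by (rule frame_coefficients[OF fr]) (rule that)
    have col: "C $ i $ j = - 2 * g Y Z x * (if i = j then 1 else 0) + 2 * g (E j) Z x * c Y $ i" for i j
    proof -
      have "c (R (E j) Y Z) = (\<chi> i. C $ i $ j)"
        by (rule c(2)[OF R_vf[OF c(3) V]]) (use C in \<open>simp add: val_def\<close>)
      moreover have "c (R (E j) Y Z) =
        (\<chi> i. - 2 * g Y Z x * (if i = j then 1 else 0) + 2 * g (E j) Z x * c Y $ i)"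
      proof (rule c(2)[OF R_vf[OF c(3) V]], rule allI)
        fix h
        have "(\<Sum>i\<in>UNIV. (- 2 * g Y Z x * (if i = j then 1 else 0) + 2 * g (E j) Z x * c Y $ i) * E i h x)
          = (\<Sum>i\<in>UNIV. if i = j then - 2 * g Y Z x * E i h x else 0)
            + 2 * g (E j) Z x * (\<Sum>i\<in>UNIV. c Y $ i * E i h x)"
          unfolding sum_distrib_left sum.distrib[symmetric]
          by (rule sum.cong) (auto simp: algebra_simps)
        then show "R (E j) Y Z h x = (\<Sum>i\<in>UNIV. (\<chi> i. - 2 * g Y Z x * (if i = j then 1 else 0)
            + 2 * g (E j) Z x * c Y $ i) $ i * E i h x)"
          unfolding RW[OF c(3)] using c(1)[OF V(1), of h] by simp
      qed
      ultimately show ?thesis by (simp add: vec_eq_iff)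
    qed
    \<comment> \<open>The expansion of \<open>Y\<close> in the frame holds at \<open>x\<close> only;
      the constant-coefficient field \<open>?V\<close> agrees with \<open>Y\<close> there, and that
      suffices for \<open>g\<close>.\<close>
    have "(\<Sum>i\<in>UNIV. c Y $ i * g (E i) Z x) = g Y Z x"
    proof -
      let ?V = "\<Sum>i\<in>UNIV. (\<lambda>_. c Y $ i) \<cdot> E i"
      have cv: "VF ((\<lambda>_. c Y $ i) \<cdot> E i)" for i by (rule vf_scale[OF c(3) smooth_fun_const])
      have Vv: "VF ?V" by (rule vf_sum) (simp_all add: cv)
      have "val x (Y - ?V) = 0"
        using c(1)[OF V(1)] by (simp add: val_def fun_eq_iff sum_fun_apply fun_scale_def)
      then have "g Z (Y - ?V) x = 0"
        using one_form_zero_at[OF g_one_form[OF V(2)] vf_diff[OF V(1) Vv]] by blast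
      then have "g Z Y x = g Z ?V x"
        by (simp add: g_diff2(1)[OF V(2,1) Vv])
      also have "\<dots> = (\<Sum>i\<in>UNIV. c Y $ i * g Z (E i) x)"
        using one_form_sum[OF g_one_form[OF V(2)] finite[of UNIV], of "\<lambda>i. (\<lambda>_. c Y $ i) \<cdot> E i"] cv
          g_scale2[OF smooth_fun_const V(2) c(3)]
        by (simp add: sum_fun_apply)
      finally show ?thesis using g_sym[OF V(2) c(3)] g_sym[OF V] by simp
    qed
    moreover have "trace C = (\<Sum>i\<in>(UNIV::'n set). - 2 * g Y Z x) + 2 * (\<Sum>i\<in>UNIV. c Y $ i * g (E i) Z x)"
      unfolding trace_def col sum_distrib_left sum.distrib[symmetric]
      by (rule sum.cong) (auto simp: algebra_simps)
    ultimately show ?thesis by (simp add: algebra_simps)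
  qed
  \<comment> \<open>By \<open>tr\<close> every admissible frame and matrix yields the same number,
    so the description in \<open>trace_at\<close> is definite; some frame exists by
    \<open>ex_frame_at\<close>.\<close>
  show "ricci \<A> D Y Z x = - 2 * (real CARD('n) - 1) * g Y Z x"
    unfolding ricci_def trace_at_def
  proof (rule the_equality)
    obtain E :: "'n \<Rightarrow> 'm vfield" where fr: "frame_at \<A> x E" using ex_frame_at by blast
    then obtain c where c: "\<And>X h. VF X \<Longrightarrow> X h x = (\<Sum>i\<in>UNIV. c X $ i * E i h x)"
      "\<And>X d. VF X \<Longrightarrow> \<forall>h. X h x = (\<Sum>i\<in>UNIV. d $ i * E i h x) \<Longrightarrow> c X = d"
      "\<And>i. VF (E i)"
      by (rule frame_coefficients) (rule that)
    have C: "\<forall>j h. val x (R (E j) Y Z) h =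
      (\<Sum>i\<in>UNIV. (\<chi> i j. c (R (E j) Y Z) $ i) $ i $ j * val x (E i) h)"
      using c(1)[OF R_vf[OF c(3) V]] by (simp add: val_def)
    show "\<exists>E (C::real^'n^'n). frame_at \<A> x E \<and>
      (\<forall>j h. val x (R (E j) Y Z) h = (\<Sum>i\<in>UNIV. C $ i $ j * val x (E i) h)) \<and>
      - 2 * (real CARD('n) - 1) * g Y Z x = trace C"
      by (rule exI, rule exI, rule conjI[OF fr conjI[OF C tr[OF fr C, symmetric]]])
    fix t assume "\<exists>E (C::real^'n^'n). frame_at \<A> x E \<and>
      (\<forall>j h. val x (R (E j) Y Z) h = (\<Sum>i\<in>UNIV. C $ i $ j * val x (E i) h)) \<and> t = trace C"
    then obtain E' and C' :: "real^'n^'n" where t: "frame_at \<A> x E'"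
      "\<forall>j h. val x (R (E' j) Y Z) h = (\<Sum>i\<in>UNIV. C' $ i $ j * val x (E' i) h)" "t = trace C'"
      by (elim exE conjE) (rule that)
    show "t = - 2 * (real CARD('n) - 1) * g Y Z x" by (rule trans[OF t(3) tr[OF t(1,2)]])
  qed
qed

text \<open>Continuity of \<open>L\<close> on the open curvature support spreads the inequality from
  \<open>x\<close> to a neighbourhood, on which \<open>S\<close> vanishes. The resulting bound on
  \<open>CARD('n)\<close> no longer mentions \<open>x\<close> and applies to the entire
  manifold.\<close>

lemma pseudosymmetric_einstein:
  assumes L: "continuous_on (curvature_support \<A> D) L" and ps: "pseudosymmetric \<A> g D L"
    and x: "x \<in> curvature_support \<A> D" "L x \<noteq> -2"
  shows "einstein \<A> g D"
proof -
  let ?N = "curvature_support \<A> D \<inter> L -` (- {-2})"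
  have "open ?N"
    by (rule continuous_open_preimage[OF L open_curvature_support]) (simp add: open_Compl)
  moreover have "x \<in> ?N" using x by simp
  moreover have "val y (S A B C) = 0" if "VF A" "VF B" "VF C" "y \<in> ?N" for A B C y
    using pseudosymmetric_defect[OF ps _ _ that(1-3), of y] that(4) by simp
  ultimately have "CARD('n) \<le> 2" by (rule card_le_2_if_constant_curvature)
  then show ?thesis
    by (intro einstein_if_constant_curvature S_zero_if_card_le_2)
qed

end

theorem theorem1:
  fixes \<A> :: "('m::{t2_space,second_countable_topology}, 'n::finite) chart set"
    and \<phi> :: "'m vfield \<Rightarrow> 'm vfield"
    and \<xi> :: "'m vfield"
    and \<eta> :: "'m vfield \<Rightarrow> 'm \<Rightarrow> real"
    and g :: "'m vfield \<Rightarrow> 'm vfield \<Rightarrow> 'm \<Rightarrow> real"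
    and nabla D :: "'m connection"
    and L :: "'m \<Rightarrow> real"
  assumes "smooth_manifold \<A>"
    and "para_sasakian \<A> \<phi> \<xi> \<eta> g nabla"
    and "D = quarter_symmetric \<phi> \<xi> \<eta> g nabla"
    and "continuous_on (curvature_support \<A> D) L"
    and "pseudosymmetric \<A> g D L"
  shows "einstein \<A> g D \<or> (\<forall>x\<in>curvature_support \<A> D. L x = -2)"
proof (rule disjCI)
  interpret para_sasakian_atlas \<A> \<phi> \<xi> \<eta> g nabla
    by unfold_locales (rule assms(1,2))+
  have D: "D = para_sasakian_atlas.D \<phi> \<xi> \<eta> g nabla"
    unfolding assms(3) D_def ..
  assume "\<not> (\<forall>x\<in>curvature_support \<A> D. L x = -2)"
  then show "einstein \<A> g D"
    using pseudosymmetric_einstein assms(4,5) unfolding D by blast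
qed

end
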